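(* Let $\{w^h\}_{h}\subset L^1(\Omega)$ with $w^h\to w$ in $L^1(\Omega)$ as $h\searrow0$ and $w\in L^2(\Omega)$. Then $$\operatorname{TV}(w)\le\liminf_{h\searrow0}\operatorname{TV}^h(w^h).$$
   Context: Setting. $\Omega\subset\mathbb{R}^d$, $d\in\{1,2,3\}$, is a bounded Lipschitz domain that is a finite union of bounded intervals ($d=1$), axis-aligned squares ($d=2$) or axis-aligned cubes ($d=3$). $\|\cdot\|$ is the Euclidean norm and $\|\phi\|_{L^\infty(\Omega;\mathbb{R}^d)}=\operatorname{ess\,sup}_{x\in\Omega}\|\phi(x)\|$. For $w\in L^1(\Omega)$, $\operatorname{TV}(w)=\sup\{\int_\Omega w\,\operatorname{div}\phi\,dx : \phi\in C^1_c(\Omega;\mathbb{R}^d),\ \sup_{x}\|\phi(x)\|\le 1\}\in[0,\infty]$. Meshes. For each $h$ in an index set of positive numbers accumulating at $0$, $\mathcal{Q}_h$ is a conforming finite element mesh of $\Omega$ of size $h$: a finite collection of intervals / axis-aligned squares / axis-aligned cubes of side length $h$ with pairwise disjoint interiors, whose union is $\Omega$ up to a Lebesgue null set, and such that two distinct closed cells intersect in the empty set or a common face. Discretized total variation. For a cell $Q\in\mathcal{Q}_h$, $RT0^h(Q)$ is the space of maps $Q\to\mathbb{R}^d$, $x\mapsto (a_i+c_ix_i)_{i=1}^d$ with $a,c\in\mathbb{R}^d$. $RT0^h=\{\phi\in H(\operatorname{div};\Omega):\phi|_Q\in RT0^h(Q)\ \forall Q\in\mathcal{Q}_h\}$ (lowest-order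 Raviart--Thomas space), and $RT0^h_0=\{\phi\in RT0^h:(\phi\cdot n)|_{\partial\Omega}\equiv0\}$ with $n$ the outer unit normal of $\Omega$. For $w\in L^1(\Omega)$, $\operatorname{TV}^h(w)=\sup\{\int_\Omega w\operatorname{div}\phi\,dx:\phi\in RT0^h_0,\ \|\phi\|_{L^\infty(\Omega;\mathbb{R}^d)}\le1\}$. *)

theory Defs
  imports "HOL-Analysis.Analysis" "HOL-Probability.Essential_Supremum"
begin

section \<open>Domains\<close>

text \<open>
  Near every boundary point the set is the strict epigraph of a Lipschitz function. The
  coordinate system is given by a unit vector \<open>\<nu>\<close> (the direction of the graph); the function
  \<open>\<gamma>\<close> lives on the hyperplane orthogonal to \<open>\<nu>\<close>, which is \<open>{0}\<close> in dimension one.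
\<close>
definition lipschitz_boundary :: "'a::euclidean_space set \<Rightarrow> bool" where
  "lipschitz_boundary \<Omega> \<longleftrightarrow>
     (\<forall>x\<in>frontier \<Omega>. \<exists>r>0. \<exists>\<nu>. \<exists>\<gamma>::'a \<Rightarrow> real. \<exists>L.
        norm \<nu> = 1 \<and> L-lipschitz_on {z. z \<bullet> \<nu> = 0} \<gamma> \<and>
        \<Omega> \<inter> ball x r = {y \<in> ball x r. \<gamma> (y - (y \<bullet> \<nu>) *\<^sub>R \<nu>) < y \<bullet> \<nu>})"

definition bounded_lipschitz_domain :: "'a::euclidean_space set \<Rightarrow> bool" where
  "bounded_lipschitz_domain \<Omega> \<longleftrightarrow>
     \<Omega> \<noteq> {} \<and> open \<Omega> \<and> connected \<Omega> \<and> bounded \<Omega> \<and> lipschitz_boundary \<Omega>"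

definition is_cube :: "real \<Rightarrow> (real^'n) set \<Rightarrow> bool" where
  "is_cube s Q \<longleftrightarrow> s > 0 \<and> (\<exists>a. Q = cbox a (a + (\<chi> i. s)))"

text \<open>
  As \<open>\<Omega>\<close> is open, being a finite union of cubes is understood for the closures.
\<close>
definition finite_union_of_cubes :: "(real^'n) set \<Rightarrow> bool" where
  "finite_union_of_cubes \<Omega> \<longleftrightarrow>
     (\<exists>\<C>. finite \<C> \<and> (\<forall>C\<in>\<C>. \<exists>s. is_cube s C) \<and> closure \<Omega> = \<Union>\<C>)"

text \<open>
  \<open>n\<close> is the outer unit normal of \<open>\<Omega>\<close> at \<open>x\<close>: the unit vector for which, to first order at
  \<open>x\<close>, the set \<open>\<Omega>\<close> is the half space \<open>{y. (y - x) \<bullet> n < 0}\<close>. No such vector exists at the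
  edges and corners of a union of cubes.
\<close>
definition outer_unit_normal :: "'a::euclidean_space set \<Rightarrow> 'a \<Rightarrow> 'a \<Rightarrow> bool" where
  "outer_unit_normal \<Omega> x n \<longleftrightarrow> x \<in> frontier \<Omega> \<and> norm n = 1 \<and>
     (\<forall>\<epsilon>>0. \<forall>\<^sub>F y in at x.
        ((y - x) \<bullet> n < - \<epsilon> * norm (y - x) \<longrightarrow> y \<in> \<Omega>) \<and>
        ((y - x) \<bullet> n > \<epsilon> * norm (y - x) \<longrightarrow> y \<notin> \<Omega>))"


section \<open>Meshes\<close>

definition conforming_mesh :: "(real^'n) set \<Rightarrow> real \<Rightarrow> (real^'n) set set \<Rightarrow> bool" where
  "conforming_mesh \<Omega> h \<Q> \<longleftrightarrow>
     finite \<Q> \<and>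
     (\<forall>Q\<in>\<Q>. is_cube h Q) \<and>
     (\<forall>Q\<in>\<Q>. \<forall>Q'\<in>\<Q>. Q \<noteq> Q' \<longrightarrow> interior Q \<inter> interior Q' = {}) \<and>
     negligible ((\<Union>\<Q> - \<Omega>) \<union> (\<Omega> - \<Union>\<Q>)) \<and>
     (\<forall>Q\<in>\<Q>. \<forall>Q'\<in>\<Q>. Q \<noteq> Q' \<longrightarrow>
        Q \<inter> Q' = {} \<or> (Q \<inter> Q') face_of Q \<and> (Q \<inter> Q') face_of Q')"


section \<open>Function spaces\<close>

text \<open>
  \<open>Ck k f\<close>: \<open>f\<close> is \<open>k\<close> times continuously differentiable on the whole space, by recursion over
  the directional derivatives.
\<close>
primrec Ck :: "nat \<Rightarrow> ('a::real_normed_vector \<Rightarrow> 'b::real_normed_vector) \<Rightarrow> bool" where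
  "Ck 0 f \<longleftrightarrow> continuous_on UNIV f"
| "Ck (Suc k) f \<longleftrightarrow>
     (\<forall>x. f differentiable (at x)) \<and> (\<forall>v. Ck k (\<lambda>x. frechet_derivative f (at x) v))"

definition compactly_supported_in :: "('a::real_normed_vector \<Rightarrow> 'b::real_normed_vector) \<Rightarrow> 'a set \<Rightarrow> bool"
  where "compactly_supported_in f \<Omega> \<longleftrightarrow>
     compact (closure {x. f x \<noteq> 0}) \<and> closure {x. f x \<noteq> 0} \<subseteq> \<Omega>"

text \<open>
  For open \<open>\<Omega>\<close>, compactly supported functions on \<open>\<Omega>\<close> are identified with their extensions by
  zero.
\<close>
definition Cc1 :: "'a::real_normed_vector set \<Rightarrow> ('a \<Rightarrow> 'b::real_normed_vector) set" where
  "Cc1 \<Omega> = {f. Ck 1 f \<and> compactly_supported_in f \<Omega>}"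

definition Cc_inf :: "'a::real_normed_vector set \<Rightarrow> ('a \<Rightarrow> 'b::real_normed_vector) set" where
  "Cc_inf \<Omega> = {f. (\<forall>k. Ck k f) \<and> compactly_supported_in f \<Omega>}"

definition L1_on :: "'a::euclidean_space set \<Rightarrow> ('a \<Rightarrow> real) set" where
  "L1_on \<Omega> = {f. integrable (lebesgue_on \<Omega>) f}"

definition L2_on :: "'a::euclidean_space set \<Rightarrow> ('a \<Rightarrow> 'b::euclidean_space) set" where
  "L2_on \<Omega> = {f \<in> borel_measurable (lebesgue_on \<Omega>).
                 integrable (lebesgue_on \<Omega>) (\<lambda>x. (norm (f x))\<^sup>2)}"

definition Linf_norm :: "'a::euclidean_space set \<Rightarrow> ('a \<Rightarrow> 'b::euclidean_space) \<Rightarrow> ereal" where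
  "Linf_norm \<Omega> f = esssup (lebesgue_on \<Omega>) (\<lambda>x. ereal (norm (f x)))"

definition gradient :: "(real^'n \<Rightarrow> real) \<Rightarrow> real^'n \<Rightarrow> real^'n" where
  "gradient \<psi> x = (\<chi> i. frechet_derivative \<psi> (at x) (axis i 1))"

definition divergence :: "(real^'n \<Rightarrow> real^'n) \<Rightarrow> real^'n \<Rightarrow> real" where
  "divergence \<phi> x = (\<Sum>i\<in>UNIV. frechet_derivative \<phi> (at x) (axis i 1) $ i)"

text \<open>
  \<open>g\<close> is the distributional divergence of \<open>\<phi>\<close> in \<open>\<Omega>\<close>; both are assumed square integrable
  wherever this is used, so that \<open>g\<close> is unique up to null sets.
\<close>
definition has_weak_divergence ::
    "(real^'n) set \<Rightarrow> (real^'n \<Rightarrow> real^'n) \<Rightarrow> (real^'n \<Rightarrow> real) \<Rightarrow> bool" where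
  "has_weak_divergence \<Omega> \<phi> g \<longleftrightarrow>
     (\<forall>\<psi>\<in>Cc_inf \<Omega>. (LINT x|lebesgue_on \<Omega>. \<phi> x \<bullet> gradient \<psi> x) =
                     - (LINT x|lebesgue_on \<Omega>. g x * \<psi> x))"

definition Hdiv :: "(real^'n) set \<Rightarrow> (real^'n \<Rightarrow> real^'n) set" where
  "Hdiv \<Omega> = {\<phi> \<in> L2_on \<Omega>. \<exists>g\<in>L2_on \<Omega>. has_weak_divergence \<Omega> \<phi> g}"


section \<open>Lowest-order Raviart--Thomas space\<close>

definition RT0_cell :: "(real^'n \<Rightarrow> real^'n) set" where
  "RT0_cell = {p. \<exists>a c. p = (\<lambda>x. \<chi> i. a $ i + c $ i * x $ i)}"

text \<open>
  Elements of \<open>Hdiv \<Omega>\<close> are determined only up to null sets, hence the restriction to a cell is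
  compared almost everywhere.
\<close>
definition RT0 :: "(real^'n) set \<Rightarrow> (real^'n) set set \<Rightarrow> (real^'n \<Rightarrow> real^'n) set" where
  "RT0 \<Omega> \<Q> = {\<phi> \<in> Hdiv \<Omega>. \<forall>Q\<in>\<Q>. \<exists>p\<in>RT0_cell. AE x in lebesgue_on Q. \<phi> x = p x}"

text \<open>
  On a closed cell \<open>Q\<close>, the trace of \<open>\<phi>\<close> on \<open>Q \<inter> frontier \<Omega>\<close> is that of the (unique, continuous)
  element \<open>p\<close> of \<open>RT0_cell\<close> representing \<open>\<phi>\<close> on \<open>Q\<close>. The normal trace is required to vanish
  wherever the outer unit normal of \<open>\<Omega>\<close> exists.
\<close>
definition RT0_0 :: "(real^'n) set \<Rightarrow> (real^'n) set set \<Rightarrow> (real^'n \<Rightarrow> real^'n) set" where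
  "RT0_0 \<Omega> \<Q> = {\<phi> \<in> RT0 \<Omega> \<Q>.
     \<forall>Q\<in>\<Q>. \<forall>p\<in>RT0_cell. (AE x in lebesgue_on Q. \<phi> x = p x) \<longrightarrow>
       (\<forall>x \<in> Q \<inter> frontier \<Omega>. \<forall>n. outer_unit_normal \<Omega> x n \<longrightarrow> p x \<bullet> n = 0)}"


section \<open>Total variation and its discretization\<close>

definition TV :: "(real^'n) set \<Rightarrow> (real^'n \<Rightarrow> real) \<Rightarrow> ereal" where
  "TV \<Omega> w = (SUP \<phi> \<in> {\<phi> \<in> Cc1 \<Omega>. \<forall>x. norm (\<phi> x) \<le> 1}.
     ereal (LINT x|lebesgue_on \<Omega>. w x * divergence \<phi> x))"

text \<open>
  The weak divergence enters as a second component \<open>g\<close> of the competitor; since it is unique up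
  to null sets, the integral does not depend on the choice of \<open>g\<close>.
\<close>
definition TVh :: "(real^'n) set \<Rightarrow> (real^'n) set set \<Rightarrow> (real^'n \<Rightarrow> real) \<Rightarrow> ereal" where
  "TVh \<Omega> \<Q> w =
     (SUP (\<phi>, g) \<in> {(\<phi>, g). \<phi> \<in> RT0_0 \<Omega> \<Q> \<and> Linf_norm \<Omega> \<phi> \<le> 1 \<and>
                              g \<in> L2_on \<Omega> \<and> has_weak_divergence \<Omega> \<phi> g}.
        ereal (LINT x|lebesgue_on \<Omega>. w x * g x))"

end

theory Submission
  imports Defs
begin

text \<open>
  Let \<open>\<phi>\<close> be an admissible field for \<open>TV\<close>, scaled by \<open>c < 1\<close>. By connectedness and conformity all
  cells of a mesh lie on a single lattice, so the Raviart--Thomas interpolant of \<open>\<phi>\<close> can be taken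
  on the whole lattice: its \<open>i\<close>-th component interpolates linearly in \<open>x\<^sub>i\<close> between the values of
  \<open>\<phi>\<^sub>i\<close> at the midpoints of the two faces orthogonal to \<open>e\<^sub>i\<close>. Midpoint values instead of face
  averages suffice because \<open>\<phi>\<close> is \<open>C\<^sup>1\<close>: by the mean value theorem and uniform continuity the
  interpolant and its divergence converge uniformly to \<open>\<phi>\<close> and \<open>div \<phi>\<close>, so for small \<open>h\<close> the
  interpolant is admissible for \<open>TV\<^sup>h\<close>. Pairing with \<open>w\<^sup>h \<rightarrow> w\<close> in \<open>L\<^sup>1\<close> and letting
  \<open>c \<rightarrow> 1\<close> gives the inequality.
\<close>

section \<open>Piecewise linear interpolation on the line\<close>

text \<open>One formula on the whole line, with nodes at the integers: an integer argument returns
  its node value, so neighbouring pieces agree there. This continuity later makes normal components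
  match across faces.\<close>

definition lin_interp :: "(int \<Rightarrow> real) \<Rightarrow> real \<Rightarrow> real" where
  "lin_interp f s = f \<lfloor>s\<rfloor> + frac s * (f (\<lfloor>s\<rfloor> + 1) - f \<lfloor>s\<rfloor>)"

text \<open>The interpolant is a convex combination of two neighbouring node values, with weights
  \<open>1 - frac s\<close> and \<open>frac s\<close>. It serves with \<open>c = 0\<close> for
  bounds and with a value of the field for errors.\<close>

lemma abs_lin_interp_diff_le:
  assumes "\<bar>f \<lfloor>s\<rfloor> - c\<bar> \<le> e" and "\<bar>f (\<lfloor>s\<rfloor> + 1) - c\<bar> \<le> e"
  shows "\<bar>lin_interp f s - c\<bar> \<le> e"
proof -
  have "lin_interp f s - c = (1 - frac s) * (f \<lfloor>s\<rfloor> - c) + frac s * (f (\<lfloor>s\<rfloor> + 1) - c)"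
    by (simp add: lin_interp_def algebra_simps)
  also have "\<bar>\<dots>\<bar> \<le> (1 - frac s) * \<bar>f \<lfloor>s\<rfloor> - c\<bar> + frac s * \<bar>f (\<lfloor>s\<rfloor> + 1) - c\<bar>"
    using frac_lt_1[of s] frac_ge_0[of s]
    by (intro order_trans[OF abs_triangle_ineq]) (simp add: abs_mult)
  also have "\<dots> \<le> (1 - frac s) * e + frac s * e"
    using frac_lt_1[of s] frac_ge_0[of s] assms by (intro add_mono mult_left_mono) auto
  finally show ?thesis by (simp add: algebra_simps)
qed

text \<open>Node values differ by at most \<open>2 * M\<close>, which bounds every slope. The proof
  separates arguments at distance at least one from closer ones, which have at most one node between
  them.\<close>

lemma lin_interp_lipschitz:
  assumes bd: "\<And>k. \<bar>f k\<bar> \<le> M"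
  shows "\<bar>lin_interp f t - lin_interp f s\<bar> \<le> 2 * M * \<bar>t - s\<bar>"
proof -
  have step: "\<bar>f k - f l\<bar> \<le> 2 * M" for k l
    using bd[of k] bd[of l] by linarith
  have M: "0 \<le> M" using bd[of 0] by linarith
  have *: "\<bar>lin_interp f t - lin_interp f s\<bar> \<le> 2 * M * (t - s)" if "s \<le> t" for s t
  proof (cases "t - s \<ge> 1")
    case True
    have "\<bar>lin_interp f r\<bar> \<le> M" for r
      using abs_lin_interp_diff_le[of f r 0 M] bd by simp
    \<comment> \<open>At distance at least one the uniform bound \<open>M\<close> on the interpolant
      is already enough.\<close>
    from this[of t] this[of s] have "\<bar>lin_interp f t - lin_interp f s\<bar> \<le> 2 * M"
      by linarith
    also have "\<dots> \<le> 2 * M * (t - s)"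
      using mult_left_mono[OF True, of "2 * M"] M by simp
    finally show ?thesis .
  next
    case False
    with that consider "\<lfloor>t\<rfloor> = \<lfloor>s\<rfloor>" | "\<lfloor>t\<rfloor> = \<lfloor>s\<rfloor> + 1" by linarith
    then show ?thesis
    proof cases
      case 1
      then have "lin_interp f t - lin_interp f s = (t - s) * (f (\<lfloor>s\<rfloor> + 1) - f \<lfloor>s\<rfloor>)"
        by (simp add: lin_interp_def frac_def algebra_simps)
      then show ?thesis
        using mult_left_mono[OF step[of "\<lfloor>s\<rfloor> + 1" "\<lfloor>s\<rfloor>"], of "t - s"] that
        by (simp add: abs_mult mult.commute)
    next
      case 2
      \<comment> \<open>The increment is split at the node between \<open>s\<close> and
        \<open>t\<close>; the pieces have lengths \<open>1 - frac s\<close> and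
        \<open>frac t\<close>.\<close>
      have "lin_interp f t - lin_interp f s
          = frac t * (f (\<lfloor>t\<rfloor> + 1) - f \<lfloor>t\<rfloor>) + (1 - frac s) * (f \<lfloor>t\<rfloor> - f \<lfloor>s\<rfloor>)"
        using 2 by (simp add: lin_interp_def algebra_simps)
      also have "\<bar>\<dots>\<bar> \<le> frac t * (2 * M) + (1 - frac s) * (2 * M)"
        using frac_lt_1[of s] frac_ge_0[of t]
        by (intro order_trans[OF abs_triangle_ineq] add_mono)
           (auto simp: abs_mult intro!: mult_left_mono step)
      also have "\<dots> = 2 * M * (t - s)"
        using 2 by (simp add: frac_def algebra_simps)
      finally show ?thesis .
    qed
  qed
  show ?thesis
    using *[of s t] *[of t s] by (cases "s \<le> t") (auto simp: abs_minus_commute)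
qed

lemma lin_interp_has_derivative:
  assumes "s \<notin> \<int>"
  shows "(lin_interp f has_real_derivative f (\<lfloor>s\<rfloor> + 1) - f \<lfloor>s\<rfloor>) (at s)"
proof -
  define k where "k = \<lfloor>s\<rfloor>"
  have sk: "of_int k < s" "s < of_int k + 1"
    using assms floor_correct[of s] by (auto simp: k_def less_le)
  have "((\<lambda>t. f k + (t - of_int k) * (f (k + 1) - f k)) has_real_derivative f (k + 1) - f k) (at s)"
    by (auto intro!: derivative_eq_intros)
  moreover have "\<forall>\<^sub>F t in nhds s. lin_interp f t = f k + (t - of_int k) * (f (k + 1) - f k)"
  proof -
    have "\<forall>\<^sub>F t in nhds s. t \<in> {of_int k <..< of_int k + 1}"
      using sk by (intro eventually_nhds_in_open) auto
    then show ?thesis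
    proof eventually_elim
      case (elim t)
      then have "\<lfloor>t\<rfloor> = k" by (auto simp: floor_eq_iff)
      then show ?case by (simp add: lin_interp_def frac_def)
    qed
  qed
  ultimately show ?thesis
    unfolding k_def by (subst DERIV_cong_ev[OF refl _ refl])
qed

section \<open>Directional weak derivatives\<close>

lemma bounded_on_bounded_support:
  fixes f :: "'a::euclidean_space \<Rightarrow> 'b::real_normed_vector"
  assumes cont: "continuous_on UNIV f" and S: "bounded S" "\<And>x. x \<notin> S \<Longrightarrow> f x = 0"
  obtains M where "M \<ge> 0" "\<And>x. norm (f x) \<le> M"
proof -
  have "compact (f ` closure S)"
    using cont S(1) by (meson compact_closure compact_continuous_image continuous_on_subset subset_UNIV)
  then have "bounded (f ` closure S)" by (rule compact_imp_bounded)
  then obtain M where M: "M > 0" "\<forall>y\<in>f ` closure S. norm y \<le> M"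
    unfolding bounded_pos by blast
  have "norm (f x) \<le> M" for x
    using M S(2)[of x] closure_subset[of S] by (cases "x \<in> S") auto
  with M(1) show ?thesis using that[of M] by auto
qed

lemma integrable_lborel_bounded_support:
  fixes f :: "'a::euclidean_space \<Rightarrow> real"
  assumes "f \<in> borel_measurable borel" "\<And>x. \<bar>f x\<bar> \<le> M" "bounded S" "\<And>x. x \<notin> S \<Longrightarrow> f x = 0"
  shows "integrable lborel f"
proof -
  obtain R where R: "S \<subseteq> cball 0 R" using bounded_subset_ballD[OF assms(3), of 0] ball_subset_cball by blast
  show ?thesis
  proof (rule Bochner_Integration.integrable_bound)
    show "integrable lborel (\<lambda>x. indicator (cball 0 R) x * M :: real)"
      using emeasure_lborel_cball_finite[of 0 R]
      by (intro integrable_mult_left integrable_real_indicator) auto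
    show "AE x in lborel. norm (f x) \<le> norm (indicator (cball 0 R) x * M :: real)"
    proof (intro AE_I2)
      fix x
      show "norm (f x) \<le> norm (indicator (cball 0 R) x * M :: real)"
        using assms(2)[of x] assms(4)[of x] R by (cases "x \<in> S") auto
    qed
  qed (use assms(1) in simp)
qed

text \<open>
  Difference quotients move from \<open>\<psi>\<close> to \<open>F\<close> by translation invariance, so no integration by parts
  in one variable is needed.
\<close>
lemma integral_directional_derivative_lborel:
  fixes F G \<psi> D :: "'a::euclidean_space \<Rightarrow> real"
  assumes F: "F \<in> borel_measurable borel" "\<And>x. \<bar>F x\<bar> \<le> B"
    and lip: "\<And>x t. \<bar>F (x + t *\<^sub>R e) - F x\<bar> \<le> L * \<bar>t\<bar>"
    and G: "AE x in lborel. ((\<lambda>t. F (x + t *\<^sub>R e)) has_real_derivative G x) (at 0)"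
    and \<psi>: "\<And>x t. ((\<lambda>t. \<psi> (x + t *\<^sub>R e)) has_real_derivative D (x + t *\<^sub>R e)) (at t)"
      "continuous_on UNIV \<psi>" "continuous_on UNIV D"
    and S: "bounded S" "\<And>x. x \<notin> S \<Longrightarrow> \<psi> x = 0" "\<And>x. x \<notin> S \<Longrightarrow> D x = 0"
    and Gm: "G \<in> borel_measurable borel"
  shows "(LINT x|lborel. F x * D x) = - (LINT x|lborel. G x * \<psi> x)"
proof -
  obtain R where R: "S \<subseteq> cball 0 R" using bounded_subset_ballD[OF S(1), of 0] ball_subset_cball by blast
  have [measurable]: "F \<in> borel_measurable borel" "G \<in> borel_measurable borel"
    "\<psi> \<in> borel_measurable borel" "D \<in> borel_measurable borel"
    using F(1) Gm \<psi>(2,3) borel_measurable_continuous_onI by auto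
  obtain M where M: "M \<ge> 0" "\<And>x. \<bar>D x\<bar> \<le> M" using bounded_on_bounded_support[OF \<psi>(3) S(1,3)] by auto
  obtain P where P: "P \<ge> 0" "\<And>x. \<bar>\<psi> x\<bar> \<le> P" using bounded_on_bounded_support[OF \<psi>(2) S(1,2)] by auto
  have B: "B \<ge> 0" using F(2)[of 0] by linarith
  have L: "L \<ge> 0" using lip[of 0 1] by simp
  \<comment> \<open>Step sizes tending to zero; being at most one, they keep all translated supports
    inside the fixed ball \<open>C\<close>.\<close>
  define \<tau> where "\<tau> n = 1 / (real n + 1)" for n
  have \<tau>: "0 < \<tau> n" "\<tau> n \<le> 1" for n by (auto simp: \<tau>_def)
  have \<tau>0: "\<tau> \<longlonglongrightarrow> 0"
    unfolding \<tau>_def using LIMSEQ_inverse_real_of_nat by (simp add: inverse_eq_divide add.commute)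
  have \<tau>at: "filterlim \<tau> (at 0) sequentially"
    using \<tau>0 \<tau>(1) by (auto simp: filterlim_at less_imp_neq[symmetric])
  have \<tau>at': "filterlim (\<lambda>n. - \<tau> n) (at 0) sequentially"
    using tendsto_minus[OF \<tau>0] \<tau>(1) by (auto simp: filterlim_at less_imp_neq[symmetric])
  \<comment> \<open>This bound on the difference quotients supplies the dominating function for
    \<open>lim1\<close>.\<close>
  have \<psi>lip: "\<bar>\<psi> (x + t *\<^sub>R e) - \<psi> x\<bar> \<le> M * t" if "t > 0" for x t
  proof -
    have "\<exists>z>0. z < t \<and>
        \<psi> (x + t *\<^sub>R e) - \<psi> (x + 0 *\<^sub>R e) = (t - 0) * D (x + z *\<^sub>R e)"
      using that \<psi>(1) by (intro MVT2[of 0 t "\<lambda>t. \<psi> (x + t *\<^sub>R e)"]) auto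
    then obtain z where "\<psi> (x + t *\<^sub>R e) - \<psi> (x + 0 *\<^sub>R e) = (t - 0) * D (x + z *\<^sub>R e)"
      by blast
    then show ?thesis using M(2) that by (simp add: abs_mult mult.commute)
  qed
  define C where "C = cball (0::'a) (R + norm e)"
  have outside: "x + t *\<^sub>R e \<notin> S" "x \<notin> S" if "x \<notin> C" "0 \<le> t" "t \<le> 1" for x t
  proof -
    have "norm (x + t *\<^sub>R e) \<ge> norm x - norm (t *\<^sub>R e)" by (rule norm_diff_ineq)
    moreover have "norm (t *\<^sub>R e) \<le> norm e" using that by (simp add: mult_left_le_one_le)
    ultimately show "x + t *\<^sub>R e \<notin> S" using R that by (auto simp: C_def)
    have "\<not> norm x \<le> R + norm e" using that(1) by (simp add: C_def)
    then have "\<not> norm x \<le> R" using norm_ge_zero[of e] by linarith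
    then show "x \<notin> S" using R by auto
  qed
  have Cfin: "integrable lborel (\<lambda>x. indicator C x * c :: real)" for c
    using emeasure_lborel_cball_finite[of 0 "R + norm e"]
    by (intro integrable_mult_left integrable_real_indicator) (auto simp: C_def)
  have lim1: "(\<lambda>n. LINT x|lborel. F x * ((\<psi> (x + \<tau> n *\<^sub>R e) - \<psi> x) / \<tau> n))
      \<longlonglongrightarrow> (LINT x|lborel. F x * D x)"
  proof (rule integral_dominated_convergence[OF _ _ Cfin[of "B * M"]])
    show "AE x in lborel. (\<lambda>n. F x * ((\<psi> (x + \<tau> n *\<^sub>R e) - \<psi> x) / \<tau> n)) \<longlonglongrightarrow> F x * D x"
    proof (intro AE_I2 tendsto_mult tendsto_const)
      fix x
      have "((\<lambda>t. (\<psi> (x + t *\<^sub>R e) - \<psi> x) / t) \<longlongrightarrow> D x) (at 0)"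
        using \<psi>(1)[of x 0] by (simp add: DERIV_def)
      then show "(\<lambda>n. (\<psi> (x + \<tau> n *\<^sub>R e) - \<psi> x) / \<tau> n) \<longlonglongrightarrow> D x"
        by (rule filterlim_compose[OF _ \<tau>at])
    qed
    show "AE x in lborel. norm (F x * ((\<psi> (x + \<tau> n *\<^sub>R e) - \<psi> x) / \<tau> n)) \<le> indicator C x * (B * M)" for n
    proof (intro AE_I2)
      fix x
      show "norm (F x * ((\<psi> (x + \<tau> n *\<^sub>R e) - \<psi> x) / \<tau> n)) \<le> indicator C x * (B * M)"
      proof (cases "x \<in> C")
        case True
        have "\<bar>(\<psi> (x + \<tau> n *\<^sub>R e) - \<psi> x) / \<tau> n\<bar> \<le> M"
          using \<psi>lip[OF \<tau>(1)[of n], of x] \<tau>(1)[of n] by (simp add: divide_simps)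
        then have "\<bar>F x\<bar> * \<bar>(\<psi> (x + \<tau> n *\<^sub>R e) - \<psi> x) / \<tau> n\<bar> \<le> B * M"
          using F(2)[of x] B by (intro mult_mono) auto
        then show ?thesis using True by (simp add: abs_mult)
      next
        case False
        then show ?thesis using outside[of x "\<tau> n"] \<tau>[of n] S(2) by (simp add: less_imp_le)
      qed
    qed
  qed measurable
  \<comment> \<open>The increment is \<open>- \<tau> n\<close> because moving a forward translation
    of \<psi> onto \<open>F\<close> produces a backward difference. The bound \<open>lip\<close>
    supplies the dominating function.\<close>
  have lim2: "(\<lambda>n. LINT x|lborel. ((F (x + (- \<tau> n) *\<^sub>R e) - F x) / (- \<tau> n)) * \<psi> x)
      \<longlonglongrightarrow> (LINT x|lborel. G x * \<psi> x)"
  proof (rule integral_dominated_convergence[OF _ _ Cfin[of "L * P"]])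
    show "AE x in lborel. (\<lambda>n. ((F (x + (- \<tau> n) *\<^sub>R e) - F x) / (- \<tau> n)) * \<psi> x) \<longlonglongrightarrow> G x * \<psi> x"
      using G
    proof eventually_elim
      case (elim x)
      have "((\<lambda>t. (F (x + t *\<^sub>R e) - F x) / t) \<longlongrightarrow> G x) (at 0)"
        using elim by (simp add: DERIV_def)
      then have "(\<lambda>n. (F (x + (- \<tau> n) *\<^sub>R e) - F x) / (- \<tau> n)) \<longlonglongrightarrow> G x"
        by (rule filterlim_compose[OF _ \<tau>at'])
      then show ?case by (intro tendsto_mult tendsto_const)
    qed
    show "AE x in lborel. norm (((F (x + (- \<tau> n) *\<^sub>R e) - F x) / (- \<tau> n)) * \<psi> x) \<le> indicator C x * (L * P)" for n
    proof (intro AE_I2)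
      fix x
      show "norm (((F (x + (- \<tau> n) *\<^sub>R e) - F x) / (- \<tau> n)) * \<psi> x) \<le> indicator C x * (L * P)"
      proof (cases "x \<in> C")
        case True
        have "\<bar>(F (x + (- \<tau> n) *\<^sub>R e) - F x) / (- \<tau> n)\<bar> \<le> L"
          using lip[of x "- \<tau> n"] \<tau>(1)[of n] by (simp add: divide_simps)
        then have "\<bar>(F (x + (- \<tau> n) *\<^sub>R e) - F x) / (- \<tau> n)\<bar> * \<bar>\<psi> x\<bar> \<le> L * P"
          using P(2)[of x] L by (intro mult_mono) auto
        then show ?thesis using True by (simp add: abs_mult)
      next
        case False
        then show ?thesis using outside(2)[of x 0] S(2) by simp
      qed
    qed
  qed measurable
  \<comment> \<open>Summation by parts at fixed step size: only the translated product differs on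
    the two sides, and \<open>shift\<close> identifies its integrals.\<close>
  have eq: "(LINT x|lborel. F x * ((\<psi> (x + \<tau> n *\<^sub>R e) - \<psi> x) / \<tau> n))
      = - (LINT x|lborel. ((F (x + (- \<tau> n) *\<^sub>R e) - F x) / (- \<tau> n)) * \<psi> x)" for n
  proof -
    define t where "t = \<tau> n"
    have t: "0 < t" "t \<le> 1" using \<tau> by (auto simp: t_def)
    have *: "\<bar>F x * \<psi> y\<bar> \<le> B * P" for x y
      using F(2)[of x] P(2)[of y] B by (auto simp: abs_mult intro!: mult_mono)
    have C: "bounded C" by (simp add: C_def)
    have i1: "integrable lborel (\<lambda>x. F x * \<psi> (x + t *\<^sub>R e))"
      by (rule integrable_lborel_bounded_support[OF _ * C])
         (use outside t S(2) in \<open>auto simp: less_imp_le\<close>)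
    have i2: "integrable lborel (\<lambda>x. F x * \<psi> x)"
      by (rule integrable_lborel_bounded_support[OF _ * C])
         (use outside(2)[of _ 0] S(2) in \<open>auto\<close>)
    have i3: "integrable lborel (\<lambda>x. F (x + (- t) *\<^sub>R e) * \<psi> x)"
      by (rule integrable_lborel_bounded_support[OF _ * C])
         (use outside(2)[of _ 0] S(2) in \<open>auto\<close>)
    have shift: "(LINT x|lborel. F (x + (- t) *\<^sub>R e) * \<psi> x) = (LINT x|lborel. F x * \<psi> (x + t *\<^sub>R e))"
      by (subst lborel_distr_plus[of "t *\<^sub>R e", symmetric], subst integral_distr)
         (auto simp: algebra_simps)
    have "(LINT x|lborel. F x * ((\<psi> (x + t *\<^sub>R e) - \<psi> x) / t))
        = (LINT x|lborel. F x * \<psi> (x + t *\<^sub>R e) - F x * \<psi> x) / t"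
      by (subst integral_divide_zero[symmetric]) (simp add: algebra_simps)
    also have "\<dots> = (LINT x|lborel. F (x + (- t) *\<^sub>R e) * \<psi> x - F x * \<psi> x) / t"
      using i1 i2 i3 shift by (subst (1 2) Bochner_Integration.integral_diff) auto
    also have "\<dots> = - (LINT x|lborel. ((F (x + (- t) *\<^sub>R e) - F x) / (- t)) * \<psi> x)"
      by (subst integral_divide_zero[symmetric], subst integral_minus[symmetric])
         (simp add: algebra_simps)
    finally show ?thesis by (simp add: t_def)
  qed
  have "(\<lambda>n. LINT x|lborel. F x * ((\<psi> (x + \<tau> n *\<^sub>R e) - \<psi> x) / \<tau> n))
      \<longlonglongrightarrow> - (LINT x|lborel. G x * \<psi> x)"
    unfolding eq using lim2 by (intro tendsto_minus)
  with lim1 show ?thesis by (rule LIMSEQ_unique)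
qed

text \<open>Heine-Cantor on a ball one unit larger than one containing \<open>S\<close>. If two
  points closer than one do not both lie in the larger ball, then both miss \<open>S\<close> and
  both values are zero.\<close>

lemma uniformly_continuous_on_compactly_supported:
  fixes f :: "'a::euclidean_space \<Rightarrow> 'b::real_normed_vector"
  assumes cont: "continuous_on UNIV f" and S: "bounded S" "\<And>x. x \<notin> S \<Longrightarrow> f x = 0"
  shows "uniformly_continuous_on UNIV f"
  unfolding uniformly_continuous_on_def
proof (intro allI impI)
  fix e :: real assume "e > 0"
  obtain R where R: "S \<subseteq> cball 0 R" using bounded_subset_ballD[OF S(1), of 0] ball_subset_cball by blast
  have "uniformly_continuous_on (cball 0 (R + 1)) f"
    using cont by (meson compact_cball compact_uniformly_continuous continuous_on_subset subset_UNIV)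
  then obtain d where d: "d > 0"
    "\<And>x y. x \<in> cball 0 (R+1) \<Longrightarrow> y \<in> cball 0 (R+1) \<Longrightarrow> dist y x < d \<Longrightarrow> dist (f y) (f x) < e"
    using \<open>e > 0\<close> unfolding uniformly_continuous_on_def by metis
  have "dist (f y) (f x) < e" if "dist y x < min d 1" for x y
  proof (cases "x \<in> cball 0 (R+1) \<and> y \<in> cball 0 (R+1)")
    case True then show ?thesis using d that by simp
  next
    case False
    have "norm x < norm y + 1" "norm y < norm x + 1"
      using that norm_triangle_ineq3[of y x] by (auto simp: dist_norm)
    with False have "x \<notin> cball 0 R" "y \<notin> cball 0 R" by auto
    with R have "x \<notin> S" "y \<notin> S" by auto
    with S(2) have "f x = 0" "f y = 0" by auto
    with \<open>e > 0\<close> show ?thesis by simp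
  qed
  with d(1) show "\<exists>d>0. \<forall>x\<in>UNIV. \<forall>x'\<in>UNIV. dist x' x < d \<longrightarrow> dist (f x') (f x) < e"
    by (intro exI[of _ "min d 1"]) auto
qed

section \<open>Conforming meshes lie on a lattice\<close>

lemma cube_eq_lambda: "cbox a (a + (\<chi> i. h)) = {x. \<forall>i. a $ i \<le> x $ i \<and> x $ i \<le> a $ i + h}"
  for a :: "real^'n"
  by (auto simp: mem_box_cart)

text \<open>
  If the corner offset in direction \<open>i\<close> were strictly between \<open>0\<close> and \<open>h\<close>, the lower face of
  the second cube would cut through the interior of an edge of the first.
\<close>
lemma cube_face_offset:
  fixes a c :: "real^'n"
  assumes face: "(cbox a (a + (\<chi> i. h)) \<inter> cbox c (c + (\<chi> i. h))) face_of cbox a (a + (\<chi> i. h))"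
    and z: "z \<in> cbox a (a + (\<chi> i. h)) \<inter> cbox c (c + (\<chi> i. h))"
    and "a $ i < c $ i"
  shows "c $ i = a $ i + h"
proof (rule ccontr)
  assume ne: "c $ i \<noteq> a $ i + h"
  have zac: "a $ j \<le> z $ j" "z $ j \<le> a $ j + h" "c $ j \<le> z $ j" "z $ j \<le> c $ j + h" for j
    using z by (auto simp: cube_eq_lambda)
  have lt: "c $ i < a $ i + h" using zac[of i] ne by linarith
  \<comment> \<open>The line through the common point \<open>z\<close> parallel to axis
    \<open>i\<close>, parametrized by its \<open>i\<close>-th coordinate.\<close>
  define p where "p s = (\<chi> j. if j = i then s else z $ j)" for s
  have pA: "p s \<in> cbox a (a + (\<chi> i. h))" if "a $ i \<le> s" "s \<le> a $ i + h" for s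
    using that zac by (auto simp: cube_eq_lambda p_def)
  have pC: "p s \<in> cbox c (c + (\<chi> i. h)) \<longleftrightarrow> c $ i \<le> s \<and> s \<le> c $ i + h" for s
    using zac by (auto simp: cube_eq_lambda p_def)
  define u where "u = (c $ i - a $ i) / h"
  have h: "h > 0" using lt assms(3) by simp
  have u: "0 < u" "u < 1" using assms(3) lt h by (auto simp: u_def field_simps)
  have "p (c $ i) = (1 - u) *\<^sub>R p (a $ i) + u *\<^sub>R p (a $ i + h)"
  proof -
    have "c $ i = a $ i + u * h" using h by (simp add: u_def)
    then show ?thesis by (simp add: vec_eq_iff p_def algebra_simps)
  qed
  moreover have "p (a $ i) \<noteq> p (a $ i + h)"
    using h by (auto simp: vec_eq_iff p_def intro!: exI[of _ i])
  ultimately have "p (c $ i) \<in> open_segment (p (a $ i)) (p (a $ i + h))"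
    using u by (auto simp: in_segment)
  moreover have "p (c $ i) \<in> cbox a (a + (\<chi> i. h)) \<inter> cbox c (c + (\<chi> i. h))"
    using pA[of "c $ i"] pC lt assms(3) h by auto
  \<comment> \<open>A face containing an interior point of a segment of the first cube contains its
    ends; the lower end lies below the second cube in direction \<open>i\<close>.\<close>
  ultimately have "p (a $ i) \<in> cbox c (c + (\<chi> i. h))"
    using face pA[of "a $ i"] pA[of "a $ i + h"] h unfolding face_of_def by fastforce
  then show False using pC assms(3) by auto
qed

definition lattice_cell :: "real^'n \<Rightarrow> real \<Rightarrow> ('n \<Rightarrow> int) \<Rightarrow> (real^'n) set" where
  "lattice_cell b h k = cbox (\<chi> i. b $ i + h * of_int (k i)) (\<chi> i. b $ i + h * (of_int (k i) + 1))"

lemma lattice_cell_eq_cube: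
  "lattice_cell b h k = cbox (\<chi> i. b $ i + h * of_int (k i)) ((\<chi> i. b $ i + h * of_int (k i)) + (\<chi> i. h))"
  unfolding lattice_cell_def by (rule arg_cong2[of _ _ _ _ cbox]) (auto simp: vec_eq_iff algebra_simps)

text \<open>The lattice is anchored at an arbitrary cell. Touching cells are offset by lattice
  vectors, so the unions of lattice and of non-lattice cells are disjoint closed sets covering the
  connected set \<Omega>; hence the second family is empty.\<close>

lemma conforming_mesh_lattice:
  fixes \<Omega> :: "(real^'n) set"
  assumes "open \<Omega>" "connected \<Omega>" and mesh: "conforming_mesh \<Omega> h \<Q>"
  obtains b where "\<And>Q. Q \<in> \<Q> \<Longrightarrow> \<exists>k. Q = lattice_cell b h k"
proof (cases "\<Q> = {}")
  case True
  then show ?thesis using that by auto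
next
  case False
  have cube: "is_cube h Q" if "Q \<in> \<Q>" for Q
    using mesh that by (auto simp: conforming_mesh_def)
  have neg: "negligible (\<Union>\<Q> - \<Omega>)" "negligible (\<Omega> - \<Union>\<Q>)"
    using mesh by (auto simp: conforming_mesh_def intro: negligible_subset)
  have fin: "finite \<Q>" using mesh by (auto simp: conforming_mesh_def)
  have closed_cells: "closed (\<Union>\<A>)" if "\<A> \<subseteq> \<Q>" for \<A>
    using cube fin finite_subset[OF that] that
    by (intro closed_Union) (auto simp: is_cube_def)
  have "open (\<Omega> - \<Union>\<Q>)" using \<open>open \<Omega>\<close> closed_cells by (intro open_Diff) auto
  \<comment> \<open>The uncovered part is open and null, so the closed cells cover all of
    \<Omega>.\<close>
  then have cover: "\<Omega> \<subseteq> \<Union>\<Q>" using neg(2) open_not_negligible by blast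
  \<comment> \<open>A cell has positive measure, so it cannot lie in the null set outside \<Omega>.
    This makes both sides of the separation nonempty in \<Omega>.\<close>
  have meets: "Q \<inter> \<Omega> \<noteq> {}" if Q: "Q \<in> \<Q>" for Q
  proof
    assume "Q \<inter> \<Omega> = {}"
    obtain a where a: "h > 0" "Q = cbox a (a + (\<chi> i. h))" using cube[OF Q] by (auto simp: is_cube_def)
    have "negligible Q" using neg(1) \<open>Q \<inter> \<Omega> = {}\<close> Q by (auto intro: negligible_subset)
    then have "box a (a + (\<chi> i. h)) = {}" unfolding a(2) by (simp add: negligible_interval)
    then show False using a(1) by (auto simp: interval_eq_empty_cart)
  qed
  obtain Q0 where "Q0 \<in> \<Q>" using False by blast
  obtain b where b: "h > 0" "Q0 = cbox b (b + (\<chi> i. h))"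
    using cube[OF \<open>Q0 \<in> \<Q>\<close>] by (auto simp: is_cube_def)
  define \<A> where "\<A> = {Q \<in> \<Q>. \<exists>k. Q = lattice_cell b h k}"
  have "Q0 \<in> \<A>"
    using b \<open>Q0 \<in> \<Q>\<close> by (auto simp: \<A>_def lattice_cell_eq_cube intro!: exI[of _ "\<lambda>_. 0"])
  have disj: "\<Union>\<A> \<inter> \<Union>(\<Q> - \<A>) = {}"
  proof (rule ccontr)
    assume "\<Union>\<A> \<inter> \<Union>(\<Q> - \<A>) \<noteq> {}"
    then obtain z Q Q' where zQ: "z \<in> Q" "z \<in> Q'" and Q: "Q \<in> \<A>" "Q' \<in> \<Q>" "Q' \<notin> \<A>" by blast
    obtain k where k: "Q = lattice_cell b h k" using Q(1) by (auto simp: \<A>_def)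
    define a where "a = (\<chi> i. b $ i + h * of_int (k i))"
    obtain c where c: "Q' = cbox c (c + (\<chi> i. h))" using cube[OF Q(2)] by (auto simp: is_cube_def)
    have a: "Q = cbox a (a + (\<chi> i. h))" unfolding k lattice_cell_eq_cube a_def ..
    have "Q \<noteq> Q'" "Q \<in> \<Q>" using Q by (auto simp: \<A>_def)
    then have face: "(Q \<inter> Q') face_of Q" "(Q' \<inter> Q) face_of Q'"
      using mesh Q(2) zQ unfolding conforming_mesh_def by (metis Int_commute disjoint_iff)+
    \<comment> \<open>By \<open>cube_face_offset\<close>, used in both orders, the only offsets of
      touching cells are \<open>0\<close>, \<open>h\<close> and \<open>- h\<close>.\<close>
    have "\<exists>m::int. c $ i = a $ i + h * of_int m" for i
    proof -
      consider "a $ i < c $ i" | "a $ i = c $ i" | "c $ i < a $ i" by linarith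
      then show ?thesis
      proof cases
        case 1
        then have "c $ i = a $ i + h"
          using cube_face_offset[OF face(1)[unfolded a c], of z i] zQ a c by auto
        then show ?thesis by (intro exI[of _ 1]) simp
      next
        case 2
        then show ?thesis by (intro exI[of _ 0]) simp
      next
        case 3
        then have "a $ i = c $ i + h"
          using cube_face_offset[OF face(2)[unfolded a c], of z i] zQ a c by auto
        then show ?thesis by (intro exI[of _ "-1"]) simp
      qed
    qed
    then obtain m :: "'n \<Rightarrow> int" where m: "c $ i = a $ i + h * of_int (m i)" for i by metis
    have "c = (\<chi> i. b $ i + h * of_int (k i + m i))"
      by (auto simp: vec_eq_iff m a_def algebra_simps)
    then have "Q' = lattice_cell b h (\<lambda>i. k i + m i)" by (simp add: c lattice_cell_eq_cube)
    with Q show False by (auto simp: \<A>_def)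
  qed
  have "\<Q> - \<A> = {}"
  proof (rule ccontr)
    assume "\<Q> - \<A> \<noteq> {}"
    then have "\<Union>(\<Q> - \<A>) \<inter> \<Omega> \<noteq> {}" using meets by blast
    moreover have "\<Union>\<A> \<inter> \<Omega> \<noteq> {}" using meets[OF \<open>Q0 \<in> \<Q>\<close>] \<open>Q0 \<in> \<A>\<close> by blast
    moreover have "\<Omega> \<subseteq> \<Union>\<A> \<union> \<Union>(\<Q> - \<A>)" using cover by blast
    moreover have "closed (\<Union>\<A>)" "closed (\<Union>(\<Q> - \<A>))"
      by (intro closed_cells; auto simp: \<A>_def)+
    ultimately show False using \<open>connected \<Omega>\<close> disj unfolding connected_closed by blast
  qed
  then show ?thesis using that[of b] by (auto simp: \<A>_def)
qed

section \<open>The Raviart--Thomas interpolant\<close>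

text \<open>The parameter \<open>s\<close> counts along axis \<open>i\<close> in units of
  \<open>h\<close>; the other coordinates are those of the centre of the cell of \<open>x\<close>.
  Integer \<open>s\<close> gives midpoints of faces orthogonal to axis \<open>i\<close>.\<close>

definition face_point :: "real^'n \<Rightarrow> real \<Rightarrow> 'n \<Rightarrow> real \<Rightarrow> real^'n \<Rightarrow> real^'n" where
  "face_point b h i s x =
     (\<chi> j. b $ j + h * (if j = i then s else of_int \<lfloor>(x $ j - b $ j) / h\<rfloor> + 1 / 2))"

definition rt_interp :: "real^'n \<Rightarrow> real \<Rightarrow> (real^'n \<Rightarrow> real^'n) \<Rightarrow> real^'n \<Rightarrow> real^'n" where
  "rt_interp b h \<phi> x =
     (\<chi> i. lin_interp (\<lambda>k. \<phi> (face_point b h i (of_int k) x) $ i) ((x $ i - b $ i) / h))"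

text \<open>The slope of the \<open>i\<close>-th component along its own axis, which is its partial
  derivative off the grid.\<close>

definition rt_interp_partial :: "real^'n \<Rightarrow> real \<Rightarrow> (real^'n \<Rightarrow> real^'n) \<Rightarrow> 'n \<Rightarrow> real^'n \<Rightarrow> real" where
  "rt_interp_partial b h \<phi> i x =
     (\<phi> (face_point b h i (of_int \<lfloor>(x $ i - b $ i) / h\<rfloor> + 1) x) $ i
      - \<phi> (face_point b h i (of_int \<lfloor>(x $ i - b $ i) / h\<rfloor>) x) $ i) / h"

definition rt_interp_div :: "real^'n \<Rightarrow> real \<Rightarrow> (real^'n \<Rightarrow> real^'n) \<Rightarrow> real^'n \<Rightarrow> real" where
  "rt_interp_div b h \<phi> x = (\<Sum>i\<in>UNIV. rt_interp_partial b h \<phi> i x)"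

text \<open>Both points lie in the same closed lattice cell, so coordinates differ by at most
  \<open>h\<close>; the cardinality comes from bounding the norm by the sum of coordinates.\<close>

lemma norm_face_point_diff_le:
  fixes x :: "real^'n"
  assumes "h > 0" and s: "of_int \<lfloor>(x $ i - b $ i) / h\<rfloor> \<le> s" "s \<le> of_int \<lfloor>(x $ i - b $ i) / h\<rfloor> + 1"
  shows "norm (face_point b h i s x - x) \<le> real CARD('n) * h"
proof -
  have "\<bar>(face_point b h i s x - x) $ j\<bar> \<le> h" for j
  proof -
    define r where "r = (x $ j - b $ j) / h"
    define u where "u = (if j = i then s else of_int \<lfloor>r\<rfloor> + 1 / 2)"
    have "x $ j = b $ j + h * r" using \<open>h > 0\<close> by (simp add: r_def)
    then have eq: "(face_point b h i s x - x) $ j = h * (u - r)"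
      by (simp add: face_point_def u_def r_def[symmetric] algebra_simps)
    have "of_int \<lfloor>r\<rfloor> \<le> u" "u \<le> of_int \<lfloor>r\<rfloor> + 1" using s by (auto simp: u_def r_def)
    then have "\<bar>u - r\<bar> \<le> 1" using floor_correct[of r] by linarith
    then show ?thesis unfolding eq using \<open>h > 0\<close> by (simp add: abs_mult)
  qed
  then have "(\<Sum>j\<in>UNIV. \<bar>(face_point b h i s x - x) $ j\<bar>) \<le> (\<Sum>j\<in>(UNIV::'n set). h)"
    by (intro sum_mono)
  then show ?thesis using norm_le_l1_cart[of "face_point b h i s x - x"] by simp
qed

text \<open>The \<open>i\<close>-th coordinate of \<open>x\<close> never enters, so the nodes stay
  fixed along axis \<open>i\<close>. This reduces directional statements about the
  \<open>i\<close>-th component to \<open>lin_interp\<close>.\<close>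

lemma face_point_shift: "face_point b h i s (x + t *\<^sub>R axis i 1) = face_point b h i s x"
  by (auto simp: face_point_def vec_eq_iff axis_def)

section \<open>Borel measurability of the interpolant and its divergence\<close>

lemma borel_measurable_vecI:
  fixes f :: "'a \<Rightarrow> real^'n"
  assumes "\<And>i. (\<lambda>x. f x $ i) \<in> borel_measurable M"
  shows "f \<in> borel_measurable M"
  using assms by (subst borel_measurable_euclidean_space) (auto simp: Basis_vec_def inner_axis)

lemma measurable_vec_nth [measurable]: "(\<lambda>x::real^'n. x $ i) \<in> borel_measurable borel"
  by (intro borel_measurable_continuous_onI continuous_intros)

lemma measurable_face_point:
  assumes [measurable]: "s \<in> borel_measurable borel"
  shows "(\<lambda>x. face_point b h i (s x) x) \<in> borel_measurable borel"
  by (rule borel_measurable_vecI) (simp add: face_point_def; measurable)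

lemma measurable_comp_face_point:
  fixes \<phi> :: "real^'n \<Rightarrow> real^'n"
  assumes "continuous_on UNIV \<phi>" "s \<in> borel_measurable borel"
  shows "(\<lambda>x. \<phi> (face_point b h i (s x) x) $ i) \<in> borel_measurable borel"
proof -
  have "(\<lambda>y. \<phi> y $ i) \<in> borel_measurable borel"
    using assms(1) by (intro borel_measurable_continuous_onI continuous_intros)
  from measurable_compose[OF measurable_face_point[OF assms(2)] this] show ?thesis .
qed

lemma measurable_rt_interp_partial:
  fixes \<phi> :: "real^'n \<Rightarrow> real^'n"
  assumes "continuous_on UNIV \<phi>"
  shows "rt_interp_partial b h \<phi> i \<in> borel_measurable borel"
proof -
  note [measurable] = measurable_comp_face_point[OF assms]
  show ?thesis unfolding rt_interp_partial_def[abs_def] by measurable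
qed

lemma measurable_rt_interp:
  fixes \<phi> :: "real^'n \<Rightarrow> real^'n"
  assumes "continuous_on UNIV \<phi>"
  shows "rt_interp b h \<phi> \<in> borel_measurable borel"
proof (rule borel_measurable_vecI)
  fix i
  note [measurable] = measurable_comp_face_point[OF assms]
  show "(\<lambda>x. rt_interp b h \<phi> x $ i) \<in> borel_measurable borel"
    unfolding rt_interp_def lin_interp_def frac_def of_int_add of_int_1 vec_lambda_beta by measurable
qed

lemma measurable_rt_interp_div:
  fixes \<phi> :: "real^'n \<Rightarrow> real^'n"
  assumes "continuous_on UNIV \<phi>"
  shows "rt_interp_div b h \<phi> \<in> borel_measurable borel"
  unfolding rt_interp_div_def[abs_def]
  by (intro borel_measurable_sum measurable_rt_interp_partial[OF assms])

section \<open>Interpolation error, bounds and directional regularity\<close>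

lemma norm_rt_interp_diff_le:
  fixes x :: "real^'n"
  assumes "h > 0" and d: "\<And>y. norm (y - x) \<le> real CARD('n) * h \<Longrightarrow> norm (\<phi> y - \<phi> x) \<le> e"
  shows "norm (rt_interp b h \<phi> x - \<phi> x) \<le> real CARD('n) * e"
proof -
  have "\<bar>(rt_interp b h \<phi> x - \<phi> x) $ i\<bar> \<le> e" for i
  proof -
    have *: "\<bar>\<phi> (face_point b h i s x) $ i - \<phi> x $ i\<bar> \<le> e"
      if "of_int \<lfloor>(x $ i - b $ i) / h\<rfloor> \<le> s" "s \<le> of_int \<lfloor>(x $ i - b $ i) / h\<rfloor> + 1" for s
      using d[OF norm_face_point_diff_le[OF \<open>h > 0\<close> that]]
        component_le_norm_cart[of "\<phi> (face_point b h i s x) - \<phi> x" i] by simp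
    show ?thesis
      unfolding rt_interp_def vector_minus_component vec_lambda_beta
      by (intro abs_lin_interp_diff_le *) auto
  qed
  then have "(\<Sum>i\<in>UNIV. \<bar>(rt_interp b h \<phi> x - \<phi> x) $ i\<bar>) \<le> (\<Sum>i\<in>(UNIV::'n set). e)"
    by (intro sum_mono)
  then show ?thesis using norm_le_l1_cart[of "rt_interp b h \<phi> x - \<phi> x"] by simp
qed

lemma rt_interp_component_bounded:
  assumes "\<And>x. norm (\<phi> x) \<le> M"
  shows "\<bar>rt_interp b h \<phi> x $ i\<bar> \<le> M"
proof -
  have "\<bar>\<phi> y $ i\<bar> \<le> M" for y
    using component_le_norm_cart[of "\<phi> y" i] assms[of y] by linarith
  then show ?thesis
    using abs_lin_interp_diff_le[of "\<lambda>k. \<phi> (face_point b h i (of_int k) x) $ i" _ 0 M]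
    by (simp add: rt_interp_def)
qed

lemma rt_interp_shift:
  "rt_interp b h \<phi> (x + t *\<^sub>R axis i 1) $ i =
     lin_interp (\<lambda>k. \<phi> (face_point b h i (of_int k) x) $ i) ((x $ i - b $ i) / h + t / h)"
proof -
  have "(x $ i + t - b $ i) / h = (x $ i - b $ i) / h + t / h"
    by (simp add: add_divide_distrib diff_divide_distrib)
  then show ?thesis by (simp add: rt_interp_def face_point_shift)
qed

lemma rt_interp_directional_lipschitz:
  assumes "h > 0" "\<And>x. norm (\<phi> x) \<le> M"
  shows "\<bar>rt_interp b h \<phi> (x + t *\<^sub>R axis i 1) $ i - rt_interp b h \<phi> x $ i\<bar> \<le> 2 * M / h * \<bar>t\<bar>"
proof -
  have "\<bar>\<phi> y $ i\<bar> \<le> M" for y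
    using component_le_norm_cart[of "\<phi> y" i] assms(2)[of y] by linarith
  \<comment> \<open>The base point is written with increment \<open>0\<close> so that
    \<open>rt_interp_shift\<close> applies to both terms; the factor \<open>1 / h\<close> comes from
    the scaled variable.\<close>
  then have "\<bar>rt_interp b h \<phi> (x + t *\<^sub>R axis i 1) $ i - rt_interp b h \<phi> (x + 0 *\<^sub>R axis i 1) $ i\<bar>
      \<le> 2 * M * \<bar>((x $ i - b $ i) / h + t / h) - ((x $ i - b $ i) / h + 0 / h)\<bar>"
    unfolding rt_interp_shift by (intro lin_interp_lipschitz) auto
  then show ?thesis using \<open>h > 0\<close> by simp
qed

lemma rt_interp_directional_derivative:
  assumes "h > 0" "(x $ i - b $ i) / h \<notin> \<int>"
  shows "((\<lambda>t. rt_interp b h \<phi> (x + t *\<^sub>R axis i 1) $ i) has_real_derivative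
            rt_interp_partial b h \<phi> i x) (at 0)"
proof -
  define f where "f = (\<lambda>k. \<phi> (face_point b h i (of_int k) x) $ i)"
  define r where "r = (x $ i - b $ i) / h"
  have 1: "(lin_interp f has_real_derivative f (\<lfloor>r\<rfloor> + 1) - f \<lfloor>r\<rfloor>) (at (r + 0 / h))"
    using lin_interp_has_derivative[of r f] assms(2) by (simp add: r_def)
  have 2: "((\<lambda>t. r + t / h) has_real_derivative 1 / h) (at 0)"
    using \<open>h > 0\<close> by (auto intro!: derivative_eq_intros)
  have "((\<lambda>t. lin_interp f (r + t / h)) has_real_derivative (f (\<lfloor>r\<rfloor> + 1) - f \<lfloor>r\<rfloor>) * (1 / h)) (at 0)"
    using DERIV_chain2[OF 1 2] .
  then show ?thesis
    by (simp add: rt_interp_shift rt_interp_partial_def f_def r_def)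
qed

section \<open>Grid hyperplanes and the interpolant on single cells\<close>

lemma negligible_grid:
  fixes b :: "real^'n"
  assumes "h > 0"
  shows "negligible {x. (x $ i - b $ i) / h \<in> \<int>}"
proof -
  have "{x. (x $ i - b $ i) / h \<in> \<int>} \<subseteq> (\<Union>k::int. {x. x $ i = b $ i + h * of_int k})"
    using assms by (auto elim!: Ints_cases simp: field_simps)
  moreover have "negligible {x :: real^'n. x $ i = c}" for c
    using negligible_hyperplane[of "axis i 1 :: real^'n" c] by (simp add: inner_axis' axis_eq_0_iff)
  then have "negligible (\<Union>k::int. {x. x $ i = b $ i + h * of_int k})"
    by (intro negligible_countable_Union) auto
  ultimately show ?thesis by (rule negligible_subset[rotated])
qed

lemma AE_lborel_not_grid:
  fixes b :: "real^'n"
  assumes "h > 0"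
  shows "AE x in lborel. (x $ i - b $ i) / h \<notin> \<int>"
proof -
  have "AE x in lebesgue. (x $ i - b $ i) / h \<notin> \<int>"
    using negligible_grid[OF assms, of i b]
    by (intro AE_I'[of "{x. (x $ i - b $ i) / h \<in> \<int>}"]) (auto simp: negligible_iff_null_sets)
  \<comment> \<open>Passing from the completed measure to \<open>lborel\<close> requires a Borel
    set; it is described by the Borel function \<open>frac\<close>.\<close>
  moreover have "{x::real^'n. (x $ i - b $ i) / h \<in> \<int>} \<in> sets borel"
    unfolding frac_eq_0_iff[symmetric] frac_def by measurable
  ultimately show ?thesis by (simp add: AE_completion_iff)
qed

text \<open>The interior matters: on the upper face in direction \<open>i\<close> the floor jumps to
  \<open>k i + 1\<close>.\<close>

lemma floor_on_cell:
  assumes "h > 0" and x: "x \<in> interior (lattice_cell b h k)"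
  shows "\<lfloor>(x $ i - b $ i) / h\<rfloor> = k i"
proof -
  have "b $ i + h * of_int (k i) < x $ i" "x $ i < b $ i + h * (of_int (k i) + 1)"
    using x by (auto simp: lattice_cell_def mem_box_cart)
  then have "of_int (k i) < (x $ i - b $ i) / h" "(x $ i - b $ i) / h < of_int (k i) + 1"
    using \<open>h > 0\<close> by (auto simp: field_simps)
  then show ?thesis by (auto simp: floor_eq_iff)
qed

lemma face_point_on_cell:
  assumes "h > 0" and x: "x \<in> interior (lattice_cell b h k)"
  shows "face_point b h i s x = (\<chi> j. b $ j + h * (if j = i then s else of_int (k j) + 1 / 2))"
  by (auto simp: face_point_def floor_on_cell[OF assms] vec_eq_iff)

text \<open>Inside a cell the nodes no longer depend on \<open>x\<close>, so component
  \<open>i\<close> is affine in its own coordinate alone.\<close>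

lemma rt_interp_on_cell:
  assumes "h > 0"
  shows "\<exists>p\<in>RT0_cell. \<forall>x \<in> interior (lattice_cell b h k). rt_interp b h \<phi> x = p x"
proof -
  define P where "P i s = \<phi> (\<chi> j. b $ j + h * (if j = i then s else of_int (k j) + 1 / 2)) $ i" for i s
  define c where "c = (\<chi> i. (P i (of_int (k i) + 1) - P i (of_int (k i))) / h)"
  \<comment> \<open>The affine function with slope \<open>c $ i\<close> extrapolated from the lower
    face to coordinate zero.\<close>
  define a where "a = (\<chi> i. P i (of_int (k i)) - c $ i * (b $ i + h * of_int (k i)))"
  have "rt_interp b h \<phi> x = (\<chi> i. a $ i + c $ i * x $ i)" if x: "x \<in> interior (lattice_cell b h k)" for x
  proof -
    have "rt_interp b h \<phi> x $ i = a $ i + c $ i * x $ i" for i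
    proof -
      have "rt_interp b h \<phi> x $ i
          = P i (of_int (k i)) + ((x $ i - b $ i) / h - of_int (k i)) * (h * c $ i)"
        using \<open>h > 0\<close>
        unfolding rt_interp_def lin_interp_def vec_lambda_beta floor_on_cell[OF assms x]
          face_point_on_cell[OF assms x] frac_def of_int_add of_int_1 by (simp add: c_def P_def)
      also have "((x $ i - b $ i) / h - of_int (k i)) * (h * c $ i)
          = (((x $ i - b $ i) / h - of_int (k i)) * h) * c $ i" by simp
      also have "((x $ i - b $ i) / h - of_int (k i)) * h = x $ i - b $ i - h * of_int (k i)"
      proof -
        have cancel: "(x $ i - b $ i) / h * h = x $ i - b $ i" using \<open>h > 0\<close> by simp
        show ?thesis unfolding left_diff_distrib cancel by (simp add: mult.commute)
      qed
      finally show ?thesis by (simp add: a_def algebra_simps)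
    qed
    then show ?thesis by (simp add: vec_eq_iff)
  qed
  moreover have "(\<lambda>x. \<chi> i. a $ i + c $ i * x $ i) \<in> RT0_cell"
    unfolding RT0_cell_def by blast
  ultimately show ?thesis by (intro bexI[of _ "\<lambda>x. \<chi> i. a $ i + c $ i * x $ i"]) auto
qed

text \<open>All nodes used inside a cell are midpoints of its own faces, hence points of the closed
  cell.\<close>

lemma rt_interp_eq_0_on_cell:
  assumes "h > 0" and x: "x \<in> interior (lattice_cell b h k)"
    and 0: "\<And>y. y \<in> lattice_cell b h k \<Longrightarrow> \<phi> y = 0"
  shows "rt_interp b h \<phi> x = 0"
proof -
  have "\<phi> (face_point b h i s x) = 0" if "of_int (k i) \<le> s" "s \<le> of_int (k i) + 1" for i s
  proof (rule 0)
    have "b $ j + h * of_int (k j) \<le> b $ j + h * (if j = i then s else of_int (k j) + 1 / 2)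
        \<and> b $ j + h * (if j = i then s else of_int (k j) + 1 / 2) \<le> b $ j + h * (of_int (k j) + 1)" for j
      using \<open>h > 0\<close> that by (auto intro!: mult_left_mono)
    then show "face_point b h i s x \<in> lattice_cell b h k"
      by (simp add: face_point_on_cell[OF assms(1,2)] lattice_cell_def mem_box_cart)
  qed
  then show ?thesis
    by (simp add: vec_eq_iff rt_interp_def lin_interp_def floor_on_cell[OF assms(1,2)])
qed

section \<open>Weak divergence of the interpolant\<close>

lemma lebesgue_on_integral_eq_lborel:
  fixes f :: "'a::euclidean_space \<Rightarrow> real"
  assumes "f \<in> borel_measurable borel" "\<Omega> \<in> sets borel" "\<And>x. x \<notin> \<Omega> \<Longrightarrow> f x = 0"
  shows "integral\<^sup>L (lebesgue_on \<Omega>) f = integral\<^sup>L lborel f"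
proof -
  have "integral\<^sup>L (lebesgue_on \<Omega>) f = (LINT x|lebesgue. indicator \<Omega> x *\<^sub>R f x)"
    using assms(2) by (intro integral_restrict_space) auto
  also have "(\<lambda>x. indicator \<Omega> x *\<^sub>R f x) = f"
    using assms(3) by (intro ext) (auto simp: indicator_def)
  also have "integral\<^sup>L lebesgue f = integral\<^sup>L lborel f"
    using assms(1) by (intro integral_completion) simp
  finally show ?thesis .
qed

lemma Ck_1D:
  assumes "Ck (Suc 0) f"
  shows "f differentiable (at x)" "continuous_on UNIV f"
    "continuous_on UNIV (\<lambda>x. frechet_derivative f (at x) v)"
  using assms by (auto intro: differentiable_imp_continuous_within simp: continuous_on_eq_continuous_within)

lemma has_vector_derivative_line:
  fixes f :: "'a::real_normed_vector \<Rightarrow> 'b::real_normed_vector"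
  assumes "\<And>x. f differentiable (at x)"
  shows "((\<lambda>t. f (x + t *\<^sub>R e)) has_vector_derivative frechet_derivative f (at (x + t *\<^sub>R e)) e) (at t)"
proof -
  define f' where "f' = frechet_derivative f (at (x + t *\<^sub>R e))"
  have f': "(f has_derivative f') (at (x + t *\<^sub>R e))"
    using assms by (simp add: f'_def frechet_derivative_works[symmetric])
  have "((\<lambda>t. x + t *\<^sub>R e) has_derivative (\<lambda>s. s *\<^sub>R e)) (at t)"
    by (auto intro!: derivative_eq_intros)
  from has_derivative_compose[OF this f']
  have "((\<lambda>t. f (x + t *\<^sub>R e)) has_derivative (\<lambda>s. f' (s *\<^sub>R e))) (at t)" .
  moreover have "linear f'" using f' by (rule has_derivative_linear)
  ultimately show ?thesis
    by (simp add: has_vector_derivative_def linear_scale f'_def[symmetric])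
qed

lemma frechet_derivative_outside_support:
  assumes "x \<notin> closure {x. f x \<noteq> 0}"
  shows "frechet_derivative f (at x) v = 0"
proof -
  have "(f has_derivative (\<lambda>_. 0)) (at x)"
    by (rule has_derivative_transform_within_open[of "\<lambda>_. 0" _ _ _ "- closure {x. f x \<noteq> 0}"])
       (use assms closure_subset[of "{x. f x \<noteq> 0}"] in auto)
  from frechet_derivative_at[OF this] show ?thesis by (metis)
qed

text \<open>Component \<open>i\<close> may jump across faces orthogonal to other axes, but along
  axis \<open>i\<close> it is Lipschitz, and the divergence involves only that derivative. Since
  \<psi> and its derivatives vanish off \<Omega>, integration by parts runs over the whole space,
  one component at a time.\<close>

lemma rt_interp_has_weak_divergence:
  fixes \<phi> :: "real^'n \<Rightarrow> real^'n"
  assumes "h > 0" "open \<Omega>" and cont: "continuous_on UNIV \<phi>" and bd: "\<And>x. norm (\<phi> x) \<le> M"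
  shows "has_weak_divergence \<Omega> (rt_interp b h \<phi>) (rt_interp_div b h \<phi>)"
  unfolding has_weak_divergence_def
proof
  fix \<psi> :: "real^'n \<Rightarrow> real" assume "\<psi> \<in> Cc_inf \<Omega>"
  then have \<psi>: "Ck (Suc 0) \<psi>" and supp: "compact (closure {x. \<psi> x \<noteq> 0})" "closure {x. \<psi> x \<noteq> 0} \<subseteq> \<Omega>"
    unfolding Cc_inf_def compactly_supported_in_def by blast+
  define S where "S = closure {x. \<psi> x \<noteq> 0}"
  have S: "bounded S" "S \<subseteq> \<Omega>" using supp compact_imp_bounded by (auto simp: S_def)
  have out: "x \<notin> S" if "x \<notin> \<Omega>" for x using that S(2) by auto
  have \<psi>0: "\<psi> x = 0" if "x \<notin> S" for x
    using that closure_subset[of "{x. \<psi> x \<noteq> 0}"] by (auto simp: S_def)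
  define D where "D i x = frechet_derivative \<psi> (at x) (axis i 1)" for i x
  have D0: "D i x = 0" if "x \<notin> S" for i x
    using that by (simp add: D_def S_def frechet_derivative_outside_support)
  have contD: "continuous_on UNIV (D i)" and cont\<psi>: "continuous_on UNIV \<psi>" for i
    using Ck_1D[OF \<psi>] by (auto simp: D_def[abs_def])
  define F where "F i x = rt_interp b h \<phi> x $ i" for i x
  define G where "G = rt_interp_partial b h \<phi>"
  have [measurable]: "F i \<in> borel_measurable borel" "G i \<in> borel_measurable borel"
    "\<psi> \<in> borel_measurable borel" "D i \<in> borel_measurable borel" for i
    using measurable_compose[OF measurable_rt_interp[OF cont] measurable_vec_nth]
      measurable_rt_interp_partial[OF cont] borel_measurable_continuous_onI[OF contD]
      borel_measurable_continuous_onI[OF cont\<psi>]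
    by (simp_all add: F_def[abs_def] G_def)
  have F: "\<bar>F i x\<bar> \<le> M" for i x
    unfolding F_def by (rule rt_interp_component_bounded[OF bd])
  have G: "\<bar>G i x\<bar> \<le> 2 * M / h" for i x
  proof -
    have "\<bar>\<phi> y $ i\<bar> \<le> M" for y
      using component_le_norm_cart[of "\<phi> y" i] bd[of y] by linarith
    from this this have "\<bar>\<phi> y $ i - \<phi> z $ i\<bar> \<le> M + M" for y z
      by (intro order_trans[OF abs_triangle_ineq4] add_mono)
    then show ?thesis using \<open>h > 0\<close> by (auto simp: G_def rt_interp_partial_def intro!: divide_right_mono)
  qed
  have parts: "(LINT x|lborel. F i x * D i x) = - (LINT x|lborel. G i x * \<psi> x)" for i
  proof (rule integral_directional_derivative_lborel[where e = "axis i 1" and S = S])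
    show "\<bar>F i (x + t *\<^sub>R axis i 1) - F i x\<bar> \<le> 2 * M / h * \<bar>t\<bar>" for x t
      unfolding F_def by (rule rt_interp_directional_lipschitz[OF \<open>h > 0\<close> bd])
    show "AE x in lborel. ((\<lambda>t. F i (x + t *\<^sub>R axis i 1)) has_real_derivative G i x) (at 0)"
      using AE_lborel_not_grid[OF \<open>h > 0\<close>, where i = i and b = b]
      by eventually_elim (use \<open>h > 0\<close> in \<open>auto simp: F_def G_def intro!: rt_interp_directional_derivative\<close>)
    show "((\<lambda>t. \<psi> (x + t *\<^sub>R axis i 1)) has_real_derivative D i (x + t *\<^sub>R axis i 1)) (at t)" for x t
      unfolding D_def has_real_derivative_iff_has_vector_derivative
      by (rule has_vector_derivative_line) (rule Ck_1D[OF \<psi>])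
  qed (use F contD cont\<psi> S(1) \<psi>0 D0 in auto)
  obtain P where P: "P \<ge> 0" "\<And>x. norm (\<psi> x) \<le> P"
    using bounded_on_bounded_support[OF cont\<psi> S(1) \<psi>0] by auto
  have iG: "integrable lborel (\<lambda>x. G i x * \<psi> x)" for i
  proof (rule integrable_lborel_bounded_support[where S = S and M = "2 * M / h * P"])
    show "\<bar>G i x * \<psi> x\<bar> \<le> 2 * M / h * P" for x
      unfolding abs_mult using G[of i x] P(2)[of x] by (intro mult_mono) auto
  qed (use S(1) \<psi>0 in auto)
  have iF: "integrable lborel (\<lambda>x. F i x * D i x)" for i
  proof -
    obtain P where P: "P \<ge> 0" "\<And>x. norm (D i x) \<le> P"
      using bounded_on_bounded_support[OF contD[of i] S(1) D0] by auto
    show ?thesis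
    proof (rule integrable_lborel_bounded_support[where S = S and M = "M * P"])
      show "\<bar>F i x * D i x\<bar> \<le> M * P" for x
        unfolding abs_mult using F[of i x] P(2)[of x] by (intro mult_mono) auto
    qed (use S(1) D0 in auto)
  qed
  have inner: "rt_interp b h \<phi> x \<bullet> gradient \<psi> x = (\<Sum>i\<in>UNIV. F i x * D i x)" for x
    by (simp add: inner_vec_def gradient_def F_def D_def)
  have div: "rt_interp_div b h \<phi> x * \<psi> x = (\<Sum>i\<in>UNIV. G i x * \<psi> x)" for x
    by (simp add: rt_interp_div_def G_def sum_distrib_right)
  have "(LINT x|lebesgue_on \<Omega>. rt_interp b h \<phi> x \<bullet> gradient \<psi> x)
      = (LINT x|lborel. (\<Sum>i\<in>UNIV. F i x * D i x))"
    unfolding inner using \<open>open \<Omega>\<close> D0 out by (intro lebesgue_on_integral_eq_lborel) (auto intro!: sum.neutral)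
  also have "\<dots> = - (LINT x|lborel. (\<Sum>i\<in>UNIV. G i x * \<psi> x))"
    using iF iG by (simp add: Bochner_Integration.integral_sum parts sum_negf)
  also have "(LINT x|lborel. (\<Sum>i\<in>UNIV. G i x * \<psi> x))
      = (LINT x|lebesgue_on \<Omega>. rt_interp_div b h \<phi> x * \<psi> x)"
    unfolding div using \<open>open \<Omega>\<close> \<psi>0 out
    by (intro lebesgue_on_integral_eq_lborel[symmetric]) (auto intro!: sum.neutral)
  finally show "(LINT x|lebesgue_on \<Omega>. rt_interp b h \<phi> x \<bullet> gradient \<psi> x)
      = - (LINT x|lebesgue_on \<Omega>. rt_interp_div b h \<phi> x * \<psi> x)" .
qed

text \<open>By the mean value theorem the difference quotient between opposite face midpoints is a
  partial derivative at a point between them, which is still within the cell distance of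
  \<open>x\<close>.\<close>

lemma rt_interp_partial_diff_le:
  fixes \<phi> :: "real^'n \<Rightarrow> real^'n"
  assumes "h > 0" and diff: "\<And>x. \<phi> differentiable (at x)"
    and e: "\<And>y. norm (y - x) \<le> real CARD('n) * h \<Longrightarrow>
      norm (frechet_derivative \<phi> (at y) (axis i 1) - frechet_derivative \<phi> (at x) (axis i 1)) \<le> e"
  shows "\<bar>rt_interp_partial b h \<phi> i x - frechet_derivative \<phi> (at x) (axis i 1) $ i\<bar> \<le> e"
proof -
  define k where "k = real_of_int \<lfloor>(x $ i - b $ i) / h\<rfloor>"
  define D where "D y = frechet_derivative \<phi> (at y) (axis i 1)" for y
  define f where "f s = \<phi> (face_point b h i s x) $ i" for s
  \<comment> \<open>In the parameter \<open>s\<close> the segment is traversed at speed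
    \<open>h\<close>; this factor cancels the division by \<open>h\<close> in
    \<open>rt_interp_partial\<close>.\<close>
  have line: "face_point b h i s x = face_point b h i 0 x + (h * s) *\<^sub>R axis i 1" for s
    by (auto simp: face_point_def vec_eq_iff axis_def)
  have f': "(f has_real_derivative h * D (face_point b h i s x) $ i) (at s)" for s
  proof -
    have "((\<lambda>t. \<phi> (face_point b h i 0 x + t *\<^sub>R axis i 1) $ i) has_vector_derivative
        D (face_point b h i 0 x + (h * s) *\<^sub>R axis i 1) $ i) (at (h * s))"
      unfolding D_def
      by (rule bounded_linear.has_vector_derivative[OF bounded_linear_vec_nth])
         (rule has_vector_derivative_line[OF diff])
    then have 1: "((\<lambda>t. \<phi> (face_point b h i 0 x + t *\<^sub>R axis i 1) $ i) has_real_derivative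
        D (face_point b h i s x) $ i) (at (h * s))"
      unfolding line[symmetric] has_real_derivative_iff_has_vector_derivative .
    have 2: "((\<lambda>s. h * s) has_real_derivative h) (at s)"
      by (auto intro!: derivative_eq_intros)
    have "f = (\<lambda>s. \<phi> (face_point b h i 0 x + (h * s) *\<^sub>R axis i 1) $ i)"
      unfolding f_def by (subst line) (rule refl)
    then show ?thesis using DERIV_chain2[OF 1 2] by (simp only: mult.commute)
  qed
  have "\<exists>z>k. z < k + 1 \<and> f (k + 1) - f k = (k + 1 - k) * (h * D (face_point b h i z x) $ i)"
    using f' by (intro MVT2) auto
  then obtain z where z: "k < z" "z < k + 1" "f (k + 1) - f k = h * D (face_point b h i z x) $ i"
    by auto
  have "rt_interp_partial b h \<phi> i x = (f (k + 1) - f k) / h"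
    by (simp add: rt_interp_partial_def f_def k_def)
  also have "\<dots> = D (face_point b h i z x) $ i" using z(3) \<open>h > 0\<close> by simp
  finally have "rt_interp_partial b h \<phi> i x - D x $ i = (D (face_point b h i z x) - D x) $ i" by simp
  also have "\<bar>\<dots>\<bar> \<le> norm (D (face_point b h i z x) - D x)" by (rule component_le_norm_cart)
  also have "\<dots> \<le> e"
    unfolding D_def by (intro e norm_face_point_diff_le) (use z \<open>h > 0\<close> in \<open>auto simp: k_def\<close>)
  finally show ?thesis by (simp add: D_def)
qed

section \<open>Membership in the discrete space and the boundary condition\<close>

lemma bounded_in_L2_on:
  fixes f :: "'a::euclidean_space \<Rightarrow> 'b::euclidean_space"
  assumes "f \<in> borel_measurable borel" "\<And>x. norm (f x) \<le> M" "\<Omega> \<in> lmeasurable"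
  shows "f \<in> L2_on \<Omega>"
proof -
  interpret finite_measure "lebesgue_on \<Omega>" using assms(3) by (rule finite_measure_lebesgue_on)
  have "f \<in> borel_measurable (lebesgue_on \<Omega>)"
    using assms(1) by (intro measurable_restrict_space1 measurable_completion) simp
  moreover have "integrable (lebesgue_on \<Omega>) (\<lambda>x. (norm (f x))\<^sup>2)"
    using assms(2) calculation by (intro integrable_const_bound[of _ "M\<^sup>2"]) (auto intro!: AE_I2 power_mono)
  ultimately show ?thesis by (simp add: L2_on_def)
qed

lemma lattice_cell_diff_le:
  fixes b :: "real^'n"
  assumes "x \<in> lattice_cell b h k" "y \<in> lattice_cell b h k"
  shows "norm (y - x) \<le> real CARD('n) * h"
proof -
  have "\<bar>(y - x) $ i\<bar> \<le> h" for i
  proof -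
    have "b $ i + h * of_int (k i) \<le> z $ i" "z $ i \<le> b $ i + h * of_int (k i) + h"
      if "z \<in> lattice_cell b h k" for z
      using that by (auto simp: lattice_cell_def mem_box_cart distrib_left add.assoc)
    from this[OF assms(1)] this[OF assms(2)] show ?thesis by (simp add: abs_le_iff)
  qed
  then have "(\<Sum>i\<in>UNIV. \<bar>(y - x) $ i\<bar>) \<le> (\<Sum>i\<in>(UNIV::'n set). h)"
    by (intro sum_mono)
  then show ?thesis using norm_le_l1_cart[of "y - x"] by simp
qed

lemma AE_interior_lattice_cell:
  "AE x in lebesgue_on (lattice_cell b h k). x \<in> interior (lattice_cell b h k)"
proof -
  have "AE x in lebesgue. x \<in> lattice_cell b h k \<longrightarrow> x \<in> interior (lattice_cell b h k)"
    unfolding lattice_cell_def interior_cbox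
    by (rule AE_I'[OF negligible_frontier_interval[unfolded negligible_iff_null_sets]]) auto
  moreover have "lattice_cell b h k \<inter> space lebesgue \<in> sets lebesgue"
    by (simp add: lattice_cell_def)
  ultimately show ?thesis by (subst AE_restrict_space_iff) auto
qed

lemma continuous_on_RT0_cell: "p \<in> RT0_cell \<Longrightarrow> continuous_on UNIV p"
  unfolding RT0_cell_def by (auto intro!: continuous_intros)

lemma lattice_cell_subset_closure_interior:
  assumes "h > 0"
  shows "lattice_cell b h k \<subseteq> closure (interior (lattice_cell b h k))"
proof -
  have "box (\<chi> i. b $ i + h * of_int (k i)) (\<chi> i. b $ i + h * (of_int (k i) + 1)) \<noteq> {}"
    using assms by (auto simp: interval_eq_empty_cart not_le)
  then show ?thesis by (simp add: lattice_cell_def)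
qed

text \<open>The interior is dense in the cell, so a nonzero value anywhere, even on the boundary,
  would make the function nonzero on a nonempty open subset of the cell, which is not null. This
  turns an almost everywhere statement into one about traces.\<close>

lemma continuous_AE_zero_on_lattice_cell:
  fixes p :: "real^'n \<Rightarrow> real^'n"
  assumes "h > 0" and cont: "continuous_on UNIV p"
    and ae: "AE x in lebesgue_on (lattice_cell b h k). p x = 0" and x: "x \<in> lattice_cell b h k"
  shows "p x = 0"
proof (rule ccontr)
  assume "p x \<noteq> 0"
  define U where "U = {y. p y \<noteq> 0}"
  have "open U"
    unfolding U_def using cont by (intro open_Collect_neq) auto
  moreover have "x \<in> closure (interior (lattice_cell b h k))"
    using x lattice_cell_subset_closure_interior[OF \<open>h > 0\<close>] by blast
  moreover have "x \<in> U" using \<open>p x \<noteq> 0\<close> by (simp add: U_def)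
  ultimately have ne: "U \<inter> interior (lattice_cell b h k) \<noteq> {}"
    using open_Int_closure_eq_empty[of U "interior (lattice_cell b h k)"] by blast
  have "lattice_cell b h k \<inter> space lebesgue \<in> sets lebesgue"
    by (simp add: lattice_cell_def)
  then have "AE x in lebesgue. x \<in> lattice_cell b h k \<longrightarrow> p x = 0"
    using ae by (subst (asm) AE_restrict_space_iff) auto
  then have "AE x in lebesgue. x \<notin> U \<inter> interior (lattice_cell b h k)"
    by eventually_elim (use interior_subset[of "lattice_cell b h k"] in \<open>auto simp: U_def\<close>)
  moreover have "U \<inter> interior (lattice_cell b h k) \<in> sets lebesgue"
    using \<open>open U\<close> by auto
  ultimately have "negligible (U \<inter> interior (lattice_cell b h k))"
    unfolding negligible_iff_null_sets by (subst (asm) AE_iff_null_sets[symmetric]) auto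
  moreover have "open (U \<inter> interior (lattice_cell b h k))"
    using \<open>open U\<close> by (intro open_Int) auto
  ultimately show False using open_not_negligible[OF _ ne] by simp
qed

text \<open>
  Cells touching the boundary miss the support of \<open>\<phi>\<close>, so the whole trace vanishes there and the
  normal plays no role.
\<close>
lemma rt_interp_in_RT0_0:
  fixes \<phi> :: "real^'n \<Rightarrow> real^'n"
  assumes "h > 0" "open \<Omega>" "\<Omega> \<in> lmeasurable"
    and cont: "continuous_on UNIV \<phi>" and bd: "\<And>x. norm (\<phi> x) \<le> M"
    and rt: "\<And>x. norm (rt_interp b h \<phi> x) \<le> M'"
    and cells: "\<And>Q. Q \<in> \<Q> \<Longrightarrow> \<exists>k. Q = lattice_cell b h k"
    and bdry: "\<And>Q y. Q \<in> \<Q> \<Longrightarrow> Q \<inter> frontier \<Omega> \<noteq> {} \<Longrightarrow> y \<in> Q \<Longrightarrow> \<phi> y = 0"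
    and div: "rt_interp_div b h \<phi> \<in> L2_on \<Omega>"
  shows "rt_interp b h \<phi> \<in> RT0_0 \<Omega> \<Q>"
proof -
  have "rt_interp b h \<phi> \<in> L2_on \<Omega>"
    by (rule bounded_in_L2_on[OF measurable_rt_interp[OF cont] rt assms(3)])
  with div rt_interp_has_weak_divergence[OF assms(1,2) cont bd]
  have "rt_interp b h \<phi> \<in> Hdiv \<Omega>" unfolding Hdiv_def by blast
  moreover have "\<exists>p\<in>RT0_cell. AE x in lebesgue_on Q. rt_interp b h \<phi> x = p x" if "Q \<in> \<Q>" for Q
  proof -
    obtain k where k: "Q = lattice_cell b h k" using cells[OF \<open>Q \<in> \<Q>\<close>] by blast
    obtain p where p: "p \<in> RT0_cell" "\<And>x. x \<in> interior (lattice_cell b h k) \<Longrightarrow> rt_interp b h \<phi> x = p x"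
      using rt_interp_on_cell[OF \<open>h > 0\<close>] by blast
    have "AE x in lebesgue_on Q. rt_interp b h \<phi> x = p x"
      using AE_interior_lattice_cell[of b h k] unfolding k by eventually_elim (rule p(2))
    with p(1) show ?thesis by blast
  qed
  \<comment> \<open>Every representative \<open>p\<close> must be handled, not only the one just
    found; each agrees almost everywhere with zero on the cell, hence vanishes there by
    continuity.\<close>
  moreover have "p x \<bullet> n = 0"
    if Q: "Q \<in> \<Q>" and p: "p \<in> RT0_cell" "AE x in lebesgue_on Q. rt_interp b h \<phi> x = p x"
      and x: "x \<in> Q \<inter> frontier \<Omega>" for Q p x n
  proof -
    obtain k where k: "Q = lattice_cell b h k" using cells[OF Q] by blast
    have "\<phi> y = 0" if "y \<in> lattice_cell b h k" for y
      using bdry[OF Q] x that k by blast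
    then have zero: "rt_interp b h \<phi> y = 0" if "y \<in> interior (lattice_cell b h k)" for y
      using rt_interp_eq_0_on_cell[OF \<open>h > 0\<close> that] by blast
    have "AE x in lebesgue_on (lattice_cell b h k). p x = 0"
      using AE_interior_lattice_cell[of b h k] p(2)[unfolded k] by eventually_elim (use zero in simp)
    then have "p x = 0"
      using continuous_AE_zero_on_lattice_cell[OF \<open>h > 0\<close> continuous_on_RT0_cell[OF p(1)]] x k by blast
    then show ?thesis by simp
  qed
  ultimately show ?thesis unfolding RT0_0_def RT0_def by auto
qed

section \<open>Approximation of test fields\<close>

lemma uniformly_continuous_eventually_small_scale:
  fixes f :: "'a::real_normed_vector \<Rightarrow> 'b::real_normed_vector"
  assumes "uniformly_continuous_on UNIV f" "e > 0" "C \<ge> 0"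
  shows "\<forall>\<^sub>F h in at_right 0. \<forall>x y. norm (y - x) \<le> C * h \<longrightarrow> norm (f y - f x) \<le> e"
proof -
  obtain d where d: "d > 0" "\<And>x y. dist y x < d \<Longrightarrow> dist (f y) (f x) < e"
    using assms(1,2) unfolding uniformly_continuous_on_def by (metis UNIV_I)
  \<comment> \<open>Adding one to \<open>C\<close> keeps the denominator positive when
    \<open>C = 0\<close>.\<close>
  have "\<forall>\<^sub>F h in at_right 0. h \<in> {0<..<d / (C + 1)}"
    using d(1) assms(3) by (intro eventually_at_right_real) simp
  then show ?thesis
  proof eventually_elim
    case (elim h)
    then have "h * (C + 1) < d" using assms(3) by (simp add: pos_less_divide_eq)
    then have "C * h < d" using elim by (simp add: algebra_simps)
    then show ?case using d(2) by (force simp: dist_norm intro: less_imp_le)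
  qed
qed

lemma Cc1_D:
  assumes "\<phi> \<in> Cc1 \<Omega>"
  shows "Ck (Suc 0) \<phi>" "compact (closure {x. \<phi> x \<noteq> 0})" "closure {x. \<phi> x \<noteq> 0} \<subseteq> \<Omega>"
  using assms unfolding Cc1_def compactly_supported_in_def One_nat_def by blast+

lemma Cc1_scaleR:
  assumes "\<phi> \<in> Cc1 \<Omega>" "c \<noteq> 0"
  shows "(\<lambda>x. c *\<^sub>R \<phi> x) \<in> Cc1 \<Omega>"
    and "frechet_derivative (\<lambda>x. c *\<^sub>R \<phi> x) (at x) v = c *\<^sub>R frechet_derivative \<phi> (at x) v"
proof -
  have diff: "\<phi> differentiable (at x)" for x using Ck_1D(1)[OF Cc1_D(1)[OF assms(1)]] .
  have fd: "frechet_derivative (\<lambda>x. c *\<^sub>R \<phi> x) (at x) v = c *\<^sub>R frechet_derivative \<phi> (at x) v" for x v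
  proof -
    have "((\<lambda>x. c *\<^sub>R \<phi> x) has_derivative (\<lambda>v. c *\<^sub>R frechet_derivative \<phi> (at x) v)) (at x)"
      using diff by (intro has_derivative_scaleR_right) (simp add: frechet_derivative_works[symmetric])
    from frechet_derivative_at[OF this] show ?thesis by metis
  qed
  show "frechet_derivative (\<lambda>x. c *\<^sub>R \<phi> x) (at x) v = c *\<^sub>R frechet_derivative \<phi> (at x) v" by (rule fd)
  have "Ck (Suc 0) (\<lambda>x. c *\<^sub>R \<phi> x)"
    using diff Ck_1D(3)[OF Cc1_D(1)[OF assms(1)]] by (auto simp: fd intro!: continuous_intros)
  then show "(\<lambda>x. c *\<^sub>R \<phi> x) \<in> Cc1 \<Omega>"
    using Cc1_D[OF assms(1)] assms(2) unfolding Cc1_def compactly_supported_in_def One_nat_def by simp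
qed

lemma divergence_scaleR:
  fixes \<phi> :: "real^'n \<Rightarrow> real^'n"
  assumes "\<phi> \<in> Cc1 \<Omega>" "c \<noteq> 0"
  shows "divergence (\<lambda>x. c *\<^sub>R \<phi> x) x = c * divergence \<phi> x"
  by (simp add: divergence_def Cc1_scaleR(2)[OF assms] sum_distrib_left)

lemma divergence_continuous_bounded:
  fixes \<phi> :: "real^'n \<Rightarrow> real^'n"
  assumes "\<phi> \<in> Cc1 \<Omega>"
  obtains M where "M \<ge> 0" "\<And>x. \<bar>divergence \<phi> x\<bar> \<le> M" "continuous_on UNIV (divergence \<phi>)"
proof -
  have cont: "continuous_on UNIV (divergence \<phi>)"
    unfolding divergence_def[abs_def]
    by (intro continuous_intros continuous_on_component Ck_1D(3)[OF Cc1_D(1)[OF assms]])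
  have "divergence \<phi> x = 0" if "x \<notin> closure {x. \<phi> x \<noteq> 0}" for x
    by (simp add: divergence_def frechet_derivative_outside_support[OF that])
  from bounded_on_bounded_support[OF cont compact_imp_bounded[OF Cc1_D(2)[OF assms]] this]
  obtain M where "M \<ge> 0" "\<And>x. norm (divergence \<phi> x) \<le> M" by blast
  then show ?thesis using that cont by simp
qed

text \<open>The margin \<open>1 - c\<close> absorbs the interpolation error, so the constraint by
  one survives. The threshold for \<open>h\<close> depends only on \<phi>, \<Omega>,
  \<open>c\<close> and \<open>e\<close>, hence is uniform over all conforming meshes of that
  size.\<close>

lemma rt_approximation:
  fixes \<phi> :: "real^'n \<Rightarrow> real^'n"
  assumes \<Omega>: "open \<Omega>" "connected \<Omega>" "bounded \<Omega>"
    and \<phi>: "\<phi> \<in> Cc1 \<Omega>" and bd: "\<And>x. norm (\<phi> x) \<le> c" and "c < 1" and "e > 0"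
  shows "\<forall>\<^sub>F h in at_right 0. \<forall>\<Q>. conforming_mesh \<Omega> h \<Q> \<longrightarrow>
    (\<exists>F g. F \<in> RT0_0 \<Omega> \<Q> \<and> Linf_norm \<Omega> F \<le> 1 \<and> g \<in> L2_on \<Omega> \<and> has_weak_divergence \<Omega> F g \<and>
       g \<in> borel_measurable borel \<and> (\<forall>x. \<bar>g x - divergence \<phi> x\<bar> \<le> e))"
proof -
  define N where "N = real CARD('n)"
  have N: "N > 0" by (simp add: N_def)
  define K where "K = closure {x. \<phi> x \<noteq> 0}"
  have K: "compact K" "K \<subseteq> \<Omega>" and C1: "Ck (Suc 0) \<phi>" using Cc1_D[OF \<phi>] by (auto simp: K_def)
  have \<phi>0: "\<phi> x = 0" if "x \<notin> K" for x
    using that closure_subset[of "{x. \<phi> x \<noteq> 0}"] by (auto simp: K_def)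
  have cont: "continuous_on UNIV \<phi>" using Ck_1D(2)[OF C1] .
  have meas: "\<Omega> \<in> lmeasurable" using \<Omega> by (simp add: lmeasurable_open)
  have uc\<phi>: "uniformly_continuous_on UNIV \<phi>"
    by (rule uniformly_continuous_on_compactly_supported[OF cont compact_imp_bounded[OF K(1)] \<phi>0])
  have ucD: "uniformly_continuous_on UNIV (\<lambda>x. frechet_derivative \<phi> (at x) v)" for v
    by (rule uniformly_continuous_on_compactly_supported[OF Ck_1D(3)[OF C1] compact_imp_bounded[OF K(1)]])
       (simp add: K_def frechet_derivative_outside_support)
  obtain d where d: "d > 0" "\<And>x y. x \<in> K \<Longrightarrow> y \<notin> \<Omega> \<Longrightarrow> d \<le> dist x y"
  proof -
    have "closed (- \<Omega>)" "K \<inter> - \<Omega> = {}" using \<Omega>(1) K(2) by auto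
    from separate_compact_closed[OF K(1) this] show ?thesis using that by blast
  qed
  obtain M where M: "M \<ge> 0" "\<And>x. \<bar>divergence \<phi> x\<bar> \<le> M"
    using divergence_continuous_bounded[OF \<phi>] by metis
  \<comment> \<open>Summing components in \<open>norm_rt_interp_diff_le\<close> costs a factor
    \<open>N\<close>, hence the tolerance \<open>(1 - c) / N\<close>; likewise \<open>e / N\<close>
    below, as the divergence has \<open>N\<close> terms.\<close>
  have ev1: "\<forall>\<^sub>F h in at_right 0. \<forall>x y. norm (y - x) \<le> N * h \<longrightarrow> norm (\<phi> y - \<phi> x) \<le> (1 - c) / N"
    using N \<open>c < 1\<close> by (intro uniformly_continuous_eventually_small_scale uc\<phi>) auto
  have ev2: "\<forall>\<^sub>F h in at_right 0. \<forall>i::'n. \<forall>x y. norm (y - x) \<le> N * h \<longrightarrow>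
      norm (frechet_derivative \<phi> (at y) (axis i 1) - frechet_derivative \<phi> (at x) (axis i 1)) \<le> e / N"
    using N \<open>e > 0\<close> by (intro eventually_all_finite uniformly_continuous_eventually_small_scale ucD) auto
  \<comment> \<open>With \<open>N * h < d\<close>, a cell touching the boundary cannot reach the
    support \<open>K\<close>, which has distance at least \<open>d\<close> from the complement of
    \<Omega>.\<close>
  have ev3: "\<forall>\<^sub>F h in at_right 0. h \<in> {0<..<d / N}"
    using N d(1) by (intro eventually_at_right_real) simp
  show ?thesis
    using ev1 ev2 ev3
  proof (eventually_elim, intro allI impI)
    fix h \<Q>
    assume h1: "\<forall>x y. norm (y - x) \<le> N * h \<longrightarrow> norm (\<phi> y - \<phi> x) \<le> (1 - c) / N"
      and h2: "\<forall>i::'n. \<forall>x y. norm (y - x) \<le> N * h \<longrightarrow>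
        norm (frechet_derivative \<phi> (at y) (axis i 1) - frechet_derivative \<phi> (at x) (axis i 1)) \<le> e / N"
      and h3: "h \<in> {0<..<d / N}" and mesh: "conforming_mesh \<Omega> h \<Q>"
    have h: "h > 0" "N * h < d" using h3 N by (auto simp: field_simps)
    obtain b where b: "\<And>Q. Q \<in> \<Q> \<Longrightarrow> \<exists>k. Q = lattice_cell b h k"
      using conforming_mesh_lattice[OF \<Omega>(1,2) mesh] by blast
    define F where "F = rt_interp b h \<phi>"
    define g where "g = rt_interp_div b h \<phi>"
    have F1: "norm (F x) \<le> 1" for x
    proof -
      have "norm (F x - \<phi> x) \<le> N * ((1 - c) / N)"
        unfolding F_def N_def using h1 h(1) by (intro norm_rt_interp_diff_le) (auto simp: N_def)
      then have "norm (F x - \<phi> x) \<le> 1 - c" using N by simp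
      then show ?thesis using bd[of x] norm_triangle_sub[of "F x" "\<phi> x"] by linarith
    qed
    have gdiff: "\<bar>g x - divergence \<phi> x\<bar> \<le> e" for x
    proof -
      have "\<bar>g x - divergence \<phi> x\<bar>
          = \<bar>\<Sum>i\<in>UNIV. rt_interp_partial b h \<phi> i x - frechet_derivative \<phi> (at x) (axis i 1) $ i\<bar>"
        by (simp add: g_def rt_interp_div_def divergence_def sum_subtractf)
      also have "\<dots> \<le> (\<Sum>i\<in>UNIV. \<bar>rt_interp_partial b h \<phi> i x - frechet_derivative \<phi> (at x) (axis i 1) $ i\<bar>)"
        by (rule sum_abs)
      also have "\<dots> \<le> (\<Sum>i\<in>(UNIV::'n set). e / N)"
        using h2 h(1) Ck_1D(1)[OF C1] by (intro sum_mono rt_interp_partial_diff_le) (auto simp: N_def)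
      also have "\<dots> = e" using N by (simp add: N_def)
      finally show ?thesis .
    qed
    have gm: "g \<in> borel_measurable borel" unfolding g_def by (rule measurable_rt_interp_div[OF cont])
    have g2: "g \<in> L2_on \<Omega>"
    proof (rule bounded_in_L2_on[OF gm _ meas])
      show "norm (g x) \<le> M + e" for x using gdiff[of x] M(2)[of x] unfolding real_norm_def by linarith
    qed
    have FR: "F \<in> RT0_0 \<Omega> \<Q>"
      unfolding F_def
    proof (rule rt_interp_in_RT0_0[OF h(1) \<Omega>(1) meas cont bd])
      show "norm (rt_interp b h \<phi> x) \<le> 1" for x using F1 by (simp add: F_def)
      show "rt_interp_div b h \<phi> \<in> L2_on \<Omega>" using g2 by (simp add: g_def)
      show "\<phi> y = 0" if Q: "Q \<in> \<Q>" "Q \<inter> frontier \<Omega> \<noteq> {}" "y \<in> Q" for Q y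
      proof (rule \<phi>0, rule)
        assume "y \<in> K"
        obtain k where k: "Q = lattice_cell b h k" using b[OF Q(1)] by blast
        obtain x where x: "x \<in> Q" "x \<in> frontier \<Omega>" using Q(2) by blast
        have "x \<notin> \<Omega>" using x(2) \<Omega>(1) by (simp add: frontier_def interior_open)
        then have "d \<le> norm (y - x)" using d(2) \<open>y \<in> K\<close> by (simp add: dist_norm)
        also have "\<dots> \<le> N * h"
          unfolding N_def using lattice_cell_diff_le x(1) Q(3) k by blast
        finally show False using h(2) by simp
      qed
    qed (rule b)
    have "F \<in> borel_measurable (lebesgue_on \<Omega>)"
      unfolding F_def using measurable_rt_interp[OF cont]
      by (intro measurable_restrict_space1 measurable_completion) simp
    then have "Linf_norm \<Omega> F \<le> 1"
      unfolding Linf_norm_def using F1 by (intro esssup_I AE_I2) (auto simp: one_ereal_def)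
    moreover have "has_weak_divergence \<Omega> F g"
      unfolding F_def g_def by (rule rt_interp_has_weak_divergence[OF h(1) \<Omega>(1) cont bd])
    ultimately show "\<exists>F g. F \<in> RT0_0 \<Omega> \<Q> \<and> Linf_norm \<Omega> F \<le> 1 \<and> g \<in> L2_on \<Omega> \<and>
        has_weak_divergence \<Omega> F g \<and> g \<in> borel_measurable borel \<and> (\<forall>x. \<bar>g x - divergence \<phi> x\<bar> \<le> e)"
      using FR g2 gm gdiff by blast
  qed
qed

section \<open>Pairing with the data and passage to the limit\<close>

lemma TVh_ge:
  assumes "\<phi> \<in> RT0_0 \<Omega> \<Q>" "Linf_norm \<Omega> \<phi> \<le> 1" "g \<in> L2_on \<Omega>" "has_weak_divergence \<Omega> \<phi> g"
  shows "ereal (LINT x|lebesgue_on \<Omega>. w x * g x) \<le> TVh \<Omega> \<Q> w"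
  unfolding TVh_def using assms by (intro SUP_upper2[of "(\<phi>, g)"]) auto

lemma integrable_mult_bounded:
  fixes f g :: "'a \<Rightarrow> real"
  assumes "integrable M f" "g \<in> borel_measurable M" "\<And>x. \<bar>g x\<bar> \<le> B"
  shows "integrable M (\<lambda>x. f x * g x)"
proof (rule Bochner_Integration.integrable_bound)
  show "integrable M (\<lambda>x. B * f x)" using assms(1) by simp
  have "\<bar>f x * g x\<bar> \<le> \<bar>B * f x\<bar>" for x
    using mult_right_mono[OF assms(3)[of x], of "\<bar>f x\<bar>"] assms(3)[of x] by (simp add: abs_mult mult.commute)
  then show "AE x in M. norm (f x * g x) \<le> norm (B * f x)" by simp
qed (use assms in simp)

text \<open>The splitting \<open>g * (f - f') + (g - g') * f'\<close> pairs convergence in mean of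
  \<open>f\<close> with bounded \<open>g\<close>, and uniform convergence of \<open>g\<close> with
  the fixed integrable \<open>f'\<close>.\<close>

lemma integral_mult_diff_le:
  fixes f f' g g' :: "'a \<Rightarrow> real"
  assumes f: "integrable M f" "integrable M f'"
    and g: "g \<in> borel_measurable M" "g' \<in> borel_measurable M"
    and bd: "\<And>x. \<bar>g x\<bar> \<le> B" "\<And>x. \<bar>g' x\<bar> \<le> B" "\<And>x. \<bar>g x - g' x\<bar> \<le> e"
  shows "\<bar>(LINT x|M. f x * g x) - (LINT x|M. f' x * g' x)\<bar>
    \<le> B * (LINT x|M. \<bar>f x - f' x\<bar>) + e * (LINT x|M. \<bar>f' x\<bar>)"
proof -
  have i: "integrable M (\<lambda>x. f x * g x)" "integrable M (\<lambda>x. f' x * g' x)"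
    using integrable_mult_bounded f g bd by blast+
  have "\<bar>(LINT x|M. f x * g x) - (LINT x|M. f' x * g' x)\<bar> = \<bar>LINT x|M. f x * g x - f' x * g' x\<bar>"
    using i by simp
  also have "\<dots> \<le> (LINT x|M. \<bar>f x * g x - f' x * g' x\<bar>)"
    by (rule integral_abs_bound)
  also have "\<dots> \<le> (LINT x|M. B * \<bar>f x - f' x\<bar> + e * \<bar>f' x\<bar>)"
  proof (rule integral_mono)
    fix x
    have "f x * g x - f' x * g' x = g x * (f x - f' x) + (g x - g' x) * f' x"
      by (simp add: algebra_simps)
    also have "\<bar>\<dots>\<bar> \<le> B * \<bar>f x - f' x\<bar> + e * \<bar>f' x\<bar>"
      by (intro order_trans[OF abs_triangle_ineq] add_mono)
         (auto simp: abs_mult intro!: mult_right_mono bd)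
    finally show "\<bar>f x * g x - f' x * g' x\<bar> \<le> B * \<bar>f x - f' x\<bar> + e * \<bar>f' x\<bar>" .
  qed (use i f in auto)
  also have "\<dots> = B * (LINT x|M. \<bar>f x - f' x\<bar>) + e * (LINT x|M. \<bar>f' x\<bar>)"
    using f by simp
  finally show ?thesis .
qed

text \<open>For small \<open>h\<close> the interpolant is a competitor in \<open>TVh\<close>, and
  its pairing with \<open>wh h\<close> is close to that of \<phi> with \<open>w\<close>. Any value
  below the limit pairing is therefore eventually exceeded.\<close>

lemma integral_divergence_le_Liminf_TVh:
  fixes \<Omega> :: "(real^'n) set" and \<phi> :: "real^'n \<Rightarrow> real^'n"
  assumes \<Omega>: "open \<Omega>" "connected \<Omega>" "bounded \<Omega>"
    and H: "H \<subseteq> {0<..}" and mesh: "\<And>h. h \<in> H \<Longrightarrow> conforming_mesh \<Omega> h (\<Q> h)"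
    and wh: "\<And>h. h \<in> H \<Longrightarrow> integrable (lebesgue_on \<Omega>) (wh h)"
    and w: "integrable (lebesgue_on \<Omega>) w"
    and conv: "((\<lambda>h. LINT x|lebesgue_on \<Omega>. \<bar>wh h x - w x\<bar>) \<longlongrightarrow> 0) (at 0 within H)"
    and \<phi>: "\<phi> \<in> Cc1 \<Omega>" "\<And>x. norm (\<phi> x) \<le> c" "c < 1"
  shows "ereal (LINT x|lebesgue_on \<Omega>. w x * divergence \<phi> x)
    \<le> Liminf (at 0 within H) (\<lambda>h. TVh \<Omega> (\<Q> h) (wh h))"
  unfolding le_Liminf_iff
proof (intro allI impI)
  define V where "V = (LINT x|lebesgue_on \<Omega>. w x * divergence \<phi> x)"
  fix y assume "y < ereal (LINT x|lebesgue_on \<Omega>. w x * divergence \<phi> x)"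
  \<comment> \<open>A real \<open>r\<close> strictly between leaves a positive gap
    \<open>V - r\<close>, shared equally by the two error terms.\<close>
  then obtain r where r: "y < ereal r" "r < V" using ereal_dense2[of y "ereal V"] by (auto simp: V_def)
  obtain M where M: "M \<ge> 0" "\<And>x. \<bar>divergence \<phi> x\<bar> \<le> M" and cd: "continuous_on UNIV (divergence \<phi>)"
    using divergence_continuous_bounded[OF \<phi>(1)] by metis
  define W where "W = (LINT x|lebesgue_on \<Omega>. \<bar>w x\<bar>)"
  have W: "W \<ge> 0" by (simp add: W_def)
  \<comment> \<open>Chosen so that \<open>e * W\<close> uses at most half of the gap; the added one
    covers \<open>W = 0\<close>.\<close>
  define e where "e = (V - r) / (2 * (W + 1))"
  have e: "e > 0" using r(2) W by (simp add: e_def)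
  have eW: "e * W \<le> (V - r) / 2"
  proof -
    have "e * W \<le> e * (W + 1)" using e by simp
    also have "\<dots> = (V - r) / 2" using W by (simp add: e_def field_simps)
    finally show ?thesis .
  qed
  \<comment> \<open>The index set contains only positive numbers, so what holds for all small
    \<open>h > 0\<close> holds eventually along \<open>H\<close>.\<close>
  have mono: "at 0 within H \<le> at_right 0" using H by (intro at_le) auto
  have Hev: "\<forall>\<^sub>F h in at 0 within H. h \<in> H" by (simp add: eventually_at_filter)
  have "\<forall>\<^sub>F h in at 0 within H. (LINT x|lebesgue_on \<Omega>. \<bar>wh h x - w x\<bar>) < (V - r) / (2 * (M + e))"
    using r(2) M(1) e by (intro order_tendstoD[OF conv]) simp
  with Hev filter_leD[OF mono rt_approximation[OF \<Omega> \<phi> e]]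
  show "\<forall>\<^sub>F h in at 0 within H. y < TVh \<Omega> (\<Q> h) (wh h)"
  proof eventually_elim
    case (elim h)
    obtain F g where Fg: "F \<in> RT0_0 \<Omega> (\<Q> h)" "Linf_norm \<Omega> F \<le> 1" "g \<in> L2_on \<Omega>" "has_weak_divergence \<Omega> F g"
      "g \<in> borel_measurable borel" "\<And>x. \<bar>g x - divergence \<phi> x\<bar> \<le> e"
      using elim(2) mesh[OF elim(1)] by blast
    have lm: "f \<in> borel_measurable (lebesgue_on \<Omega>)" if "f \<in> borel_measurable borel" for f :: "real^'n \<Rightarrow> real"
      using that by (intro measurable_restrict_space1 measurable_completion) simp
    have est: "\<bar>(LINT x|lebesgue_on \<Omega>. wh h x * g x) - V\<bar>
        \<le> (M + e) * (LINT x|lebesgue_on \<Omega>. \<bar>wh h x - w x\<bar>) + e * W"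
      unfolding V_def W_def
    proof (rule integral_mult_diff_le[OF wh[OF elim(1)] w lm[OF Fg(5)] lm])
      show "divergence \<phi> \<in> borel_measurable borel" by (rule borel_measurable_continuous_onI[OF cd])
      show "\<bar>g x\<bar> \<le> M + e" for x using Fg(6)[of x] M(2)[of x] by linarith
      show "\<bar>divergence \<phi> x\<bar> \<le> M + e" for x using M(2)[of x] e by linarith
    qed (rule Fg(6))
    \<comment> \<open>Here \<open>M + e\<close> bounds the discrete divergence, and the threshold on
      the error of \<open>wh h\<close> keeps this term below half of the gap.\<close>
    have "(M + e) * (LINT x|lebesgue_on \<Omega>. \<bar>wh h x - w x\<bar>) < (M + e) * ((V - r) / (2 * (M + e)))"
      using elim(3) M(1) e by (intro mult_strict_left_mono) auto
    also have "\<dots> = (V - r) / 2"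
    proof -
      have "B * (t / (2 * B)) = t / 2" if "B > 0" for B t :: real using that by simp
      then show ?thesis using M(1) e by (simp only: add_nonneg_pos)
    qed
    finally have "\<bar>(LINT x|lebesgue_on \<Omega>. wh h x * g x) - V\<bar> < (V - r) / 2 + (V - r) / 2"
      using est eW by (meson add_less_le_mono order_le_less_trans)
    then have "r < (LINT x|lebesgue_on \<Omega>. wh h x * g x)"
      by (simp add: abs_less_iff)
    then have "ereal r < TVh \<Omega> (\<Q> h) (wh h)"
      using TVh_ge[OF Fg(1-4), of "wh h"] by (meson ereal_less_eq(3) less_ereal.simps(1) order_less_le_trans)
    with r(1) show ?case by (rule less_trans)
  qed
qed

theorem theorem2p9:
  fixes \<Omega> :: "(real^'n) set"
    and H :: "real set"
    and \<Q> :: "real \<Rightarrow> (real^'n) set set"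
    and wh :: "real \<Rightarrow> real^'n \<Rightarrow> real"
    and w :: "real^'n \<Rightarrow> real"
  assumes dim: "CARD('n) \<in> {1, 2, 3}"
    and domain: "bounded_lipschitz_domain \<Omega>"
    and cubes: "finite_union_of_cubes \<Omega>"
    and H_pos: "H \<subseteq> {0<..}"
    and H_acc: "0 islimpt H"
    and mesh: "\<And>h. h \<in> H \<Longrightarrow> conforming_mesh \<Omega> h (\<Q> h)"
    and wh_L1: "\<And>h. h \<in> H \<Longrightarrow> wh h \<in> L1_on \<Omega>"
    and w_L1: "w \<in> L1_on \<Omega>"
    and conv: "((\<lambda>h. LINT x|lebesgue_on \<Omega>. \<bar>wh h x - w x\<bar>) \<longlongrightarrow> 0) (at 0 within H)"
    and w_L2: "w \<in> L2_on \<Omega>"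
  shows "TV \<Omega> w \<le> Liminf (at 0 within H) (\<lambda>h. TVh \<Omega> (\<Q> h) (wh h))"
  unfolding TV_def
proof (rule SUP_least)
  fix \<phi> :: "real^'n \<Rightarrow> real^'n"
  assume "\<phi> \<in> {\<phi> \<in> Cc1 \<Omega>. \<forall>x. norm (\<phi> x) \<le> 1}"
  then have \<phi>: "\<phi> \<in> Cc1 \<Omega>" "\<And>x. norm (\<phi> x) \<le> 1" by auto
  define V where "V = (LINT x|lebesgue_on \<Omega>. w x * divergence \<phi> x)"
  \<comment> \<open>Scaling factors tending to one from below; the shift by two makes already
    \<open>c 0 = 1 / 2\<close> nonzero, as \<open>Cc1_scaleR\<close> requires.\<close>
  define c where "c n = 1 - 1 / (real n + 2)" for n
  have c: "0 < c n" "c n < 1" for n by (auto simp: c_def)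
  have "ereal (c n * V) \<le> Liminf (at 0 within H) (\<lambda>h. TVh \<Omega> (\<Q> h) (wh h))" for n
  proof -
    have nz: "c n \<noteq> 0" using c(1)[of n] by simp
    have "c n * V = (LINT x|lebesgue_on \<Omega>. w x * divergence (\<lambda>x. c n *\<^sub>R \<phi> x) x)"
      unfolding divergence_scaleR[OF \<phi>(1) nz] V_def
      by (subst integral_mult_right_zero[symmetric]) (simp add: ac_simps)
    moreover have "norm (c n *\<^sub>R \<phi> x) \<le> c n" for x
      using \<phi>(2)[of x] c(1)[of n] by simp
    ultimately show ?thesis
      using integral_divergence_le_Liminf_TVh[of \<Omega> H \<Q> wh w "\<lambda>x. c n *\<^sub>R \<phi> x" "c n"]
        domain H_pos mesh wh_L1 w_L1 conv Cc1_scaleR(1)[OF \<phi>(1) nz] c(2)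
      by (simp add: bounded_lipschitz_domain_def L1_on_def)
  qed
  \<comment> \<open>The limit inferior does not depend on \<open>n\<close>, so the bounds for the
    scaled fields pass to the limit.\<close>
  moreover have "(\<lambda>n. ereal (c n * V)) \<longlonglongrightarrow> ereal V"
  proof -
    have "c \<longlonglongrightarrow> 1"
      unfolding c_def
      using tendsto_diff[OF tendsto_const LIMSEQ_ignore_initial_segment[OF LIMSEQ_inverse_real_of_nat, of 1], of 1]
      by (simp add: inverse_eq_divide add_ac)
    from tendsto_mult[OF this tendsto_const[of V]] show ?thesis by simp
  qed
  ultimately show "ereal (LINT x|lebesgue_on \<Omega>. w x * divergence \<phi> x)
      \<le> Liminf (at 0 within H) (\<lambda>h. TVh \<Omega> (\<Q> h) (wh h))"
    unfolding V_def[symmetric] using Lim_bounded[of "\<lambda>n. ereal (c n * V)" "ereal V" 0] by blast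
qed

end
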